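(* The Minimum-Power Edge-Multi-Cover problem (MPEMC) admits a polynomial-time $O(\log k)$-approximation algorithm, where $k=\max_{v\in V} r(v)$ is the maximum degree bound of the instance.
   Context: All graphs are undirected and simple. For a graph $(V,J)$ with edge costs $c$, and $v\in V$, let $\delta_J(v)$ be the set of edges of $J$ incident to $v$ and $d_J(v)=|\delta_J(v)|$. The power of $v$ w.r.t. $J$ is $p_J(v)=\max_{e\in\delta_J(v)}c(e)$ if $\delta_J(v)\neq\emptyset$ and $p_J(v)=0$ otherwise; for $V'\subseteq V$, $p_J(V')=\sum_{v\in V'}p_J(v)$, and the power of $J$ is $p_J(V)$. Given degree bounds $r=\{r(v):v\in V\}$ (nonnegative integers), an edge set $J$ on $V$ is an $r$-edge cover if $d_J(v)\ge r(v)$ for every $v\in V$. MPEMC: given a graph $G=(V,E)$ with edge costs $\{c(e):e\in E\}$ and degree bounds $r$, find an $r$-edge cover $J\subseteq E$ of minimum power $p_J(V)$. A $\rho$-approximation algorithm is a polynomial-time algorithm returning a feasible solution whose power is at most $\rho$ times the optimum. *)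

theory Defs
  imports
    Complex_Main
    "HOL-Library.Log_Nat"
    "HOL-Library.Landau_Symbols"
    "HOL-Computational_Algebra.Polynomial"
begin

section \<open>Minimum-power edge-multi-covers\<close>

text \<open>
  The edge \<open>uv\<close> of an undirected simple graph is the two-element set \<open>{u, v}\<close>.
\<close>

record 'v mpemc =
  verts :: "'v set"
  edges :: "'v set set"
  cost :: "'v set \<Rightarrow> rat"
  req :: "'v \<Rightarrow> nat"

definition mpemc_instance :: "'v mpemc \<Rightarrow> bool" where
  "mpemc_instance I \<longleftrightarrow>
     finite (verts I) \<and>
     edges I \<subseteq> {{u, v} |u v. u \<in> verts I \<and> v \<in> verts I \<and> u \<noteq> v} \<and>
     (\<forall>e\<in>edges I. 0 \<le> cost I e)"

definition incident :: "'v set set \<Rightarrow> 'v \<Rightarrow> 'v set set" where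
  "incident J v = {e \<in> J. v \<in> e}"

definition degree_in :: "'v set set \<Rightarrow> 'v \<Rightarrow> nat" where
  "degree_in J v = card (incident J v)"

definition node_power :: "('v set \<Rightarrow> rat) \<Rightarrow> 'v set set \<Rightarrow> 'v \<Rightarrow> rat" where
  "node_power c J v = (if incident J v = {} then 0 else Max (c ` incident J v))"

definition power_of :: "('v set \<Rightarrow> rat) \<Rightarrow> 'v set set \<Rightarrow> 'v set \<Rightarrow> rat" where
  "power_of c J V = (\<Sum>v\<in>V. node_power c J v)"

definition edge_cover_of :: "'v mpemc \<Rightarrow> 'v set set \<Rightarrow> bool" where
  "edge_cover_of I J \<longleftrightarrow> J \<subseteq> edges I \<and> (\<forall>v\<in>verts I. req I v \<le> degree_in J v)"

definition opt_power :: "'v mpemc \<Rightarrow> rat" where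
  "opt_power I = Min {power_of (cost I) J (verts I) |J. edge_cover_of I J}"

text \<open>Inserting \<open>0\<close> only matters for the graph without vertices.\<close>

definition max_req :: "'v mpemc \<Rightarrow> nat" where
  "max_req I = Max (insert 0 (req I ` verts I))"


section \<open>A machine model for polynomial time\<close>

text \<open>
  Algorithms are programs of a first-order functional language (pure LISP with natural numbers as
  atoms) with a call-by-value semantics. Every evaluation step costs the bit size of the value it
  produces. As this pays for copying every intermediate value, including the arguments of calls,
  the total cost bounds the time of a naive interpreter on a Turing machine up to a polynomial;
  conversely, a Turing machine is simulated with polynomial overhead, its tape being kept as two
  lists. So polynomial cost is polynomial time in the usual sense.
\<close>

datatype val = Num nat | Pair val val

text \<open>\<open>floorlog 2 n\<close> is the number of binary digits of \<open>n\<close>.\<close>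

fun vsize :: "val \<Rightarrow> nat" where
  "vsize (Num n) = 1 + floorlog 2 n"
| "vsize (Pair a b) = 1 + vsize a + vsize b"

datatype binop = Plus | Minus | Times | Div | Mod | Leq

fun binop_sem :: "binop \<Rightarrow> nat \<Rightarrow> nat \<Rightarrow> nat" where
  "binop_sem Plus m n = m + n"
| "binop_sem Minus m n = m - n"
| "binop_sem Times m n = m * n"
| "binop_sem Div m n = m div n"
| "binop_sem Mod m n = m mod n"
| "binop_sem Leq m n = (if m \<le> n then 1 else 0)"

datatype expr =
    Var nat
  | Lit nat
  | MkPair expr expr
  | Fst expr
  | Snd expr
  | IsPair expr
  | Bin binop expr expr
  | IfNZ expr expr expr
  | LetIn expr expr
  | Call nat "expr list"

text \<open>
  Variables are de Bruijn indices into the environment. A program is the list of the bodies of its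
  mutually recursive functions; the body of a function is evaluated in the environment of its
  arguments. \<open>IfNZ\<close> takes the first branch unless the condition is \<open>Num 0\<close>.
  \<open>eval P env e v t\<close>: in the program \<open>P\<close>, the expression \<open>e\<close> evaluates to \<open>v\<close> at cost \<open>t\<close>.
\<close>

type_synonym prog = "expr list"

inductive eval :: "prog \<Rightarrow> val list \<Rightarrow> expr \<Rightarrow> val \<Rightarrow> nat \<Rightarrow> bool"
  and evals :: "prog \<Rightarrow> val list \<Rightarrow> expr list \<Rightarrow> val list \<Rightarrow> nat \<Rightarrow> bool"
  for P :: prog where
  Var: "i < length env \<Longrightarrow> eval P env (Var i) (env ! i) (vsize (env ! i))"
| Lit: "eval P env (Lit n) (Num n) (vsize (Num n))"
| MkPair: "eval P env a u s \<Longrightarrow> eval P env b v t \<Longrightarrow>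
    eval P env (MkPair a b) (Pair u v) (s + t + vsize (Pair u v))"
| Fst: "eval P env e (Pair u v) t \<Longrightarrow> eval P env (Fst e) u (t + vsize u)"
| Snd: "eval P env e (Pair u v) t \<Longrightarrow> eval P env (Snd e) v (t + vsize v)"
| IsPair_Num: "eval P env e (Num n) t \<Longrightarrow>
    eval P env (IsPair e) (Num 0) (t + vsize (Num 0))"
| IsPair_Pair: "eval P env e (Pair u v) t \<Longrightarrow>
    eval P env (IsPair e) (Num 1) (t + vsize (Num 1))"
| Bin: "eval P env a (Num m) s \<Longrightarrow> eval P env b (Num n) t \<Longrightarrow>
    eval P env (Bin f a b) (Num (binop_sem f m n)) (s + t + vsize (Num (binop_sem f m n)))"
| IfNZ_True: "eval P env c w s \<Longrightarrow> w \<noteq> Num 0 \<Longrightarrow> eval P env a v t \<Longrightarrow>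
    eval P env (IfNZ c a b) v (s + t + vsize v)"
| IfNZ_False: "eval P env c (Num 0) s \<Longrightarrow> eval P env b v t \<Longrightarrow>
    eval P env (IfNZ c a b) v (s + t + vsize v)"
| LetIn: "eval P env a u s \<Longrightarrow> eval P (u # env) b v t \<Longrightarrow>
    eval P env (LetIn a b) v (s + t + vsize v)"
| Call: "f < length P \<Longrightarrow> evals P env as us s \<Longrightarrow> eval P us (P ! f) v t \<Longrightarrow>
    eval P env (Call f as) v (s + t + vsize v)"
| Nil: "evals P env [] [] 0"
| Cons: "eval P env a u s \<Longrightarrow> evals P env as us t \<Longrightarrow> evals P env (a # as) (u # us) (s + t)"

inductive_cases eval_elims:
  "eval P env (Var i) v t"
  "eval P env (Lit n) v t"
  "eval P env (MkPair a b) v t"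
  "eval P env (Fst e) v t"
  "eval P env (Snd e) v t"
  "eval P env (IsPair e) v t"
  "eval P env (Bin f a b) v t"
  "eval P env (IfNZ c a b) v t"
  "eval P env (LetIn a b) v t"
  "eval P env (Call f as) v t"
  "evals P env [] vs t"
  "evals P env (a # as) vs t"

lemma eval_deterministic:
  "eval P env e v t \<Longrightarrow> eval P env e v' t' \<Longrightarrow> v' = v \<and> t' = t"
  "evals P env es vs t \<Longrightarrow> evals P env es vs' t' \<Longrightarrow> vs' = vs \<and> t' = t"
proof (induction arbitrary: v' t' and vs' t' rule: eval_evals.inducts)
  case (Var i env) show ?case using Var.prems by (cases rule: eval.cases) auto
next
  case (Lit env n) show ?case using Lit.prems by (cases rule: eval.cases) auto
next
  case (MkPair env a u s b v t)
  from MkPair.prems show ?case by (rule eval_elims(3)) (auto dest: MkPair.IH(2,4))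
next
  case (Fst env e u v t)
  from Fst.prems show ?case by (rule eval_elims(4)) (auto dest: Fst.IH(2))
next
  case (Snd env e u v t)
  from Snd.prems show ?case by (rule eval_elims(5)) (auto dest: Snd.IH(2))
next
  case (IsPair_Num env e n t)
  from IsPair_Num.prems show ?case by (rule eval_elims(6)) (auto dest: IsPair_Num.IH(2))
next
  case (IsPair_Pair env e u v t)
  from IsPair_Pair.prems show ?case by (rule eval_elims(6)) (auto dest: IsPair_Pair.IH(2))
next
  case (Bin env a m s b n t f)
  from Bin.prems show ?case by (rule eval_elims(7)) (auto dest: Bin.IH(2,4))
next
  case (IfNZ_True env c w s a v t b)
  from IfNZ_True.prems show ?case
    by (rule eval_elims(8)) (use IfNZ_True.hyps in \<open>auto dest: IfNZ_True.IH(2,4)\<close>)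
next
  case (IfNZ_False env c s b v t a)
  from IfNZ_False.prems show ?case by (rule eval_elims(8)) (auto dest: IfNZ_False.IH(2,4))
next
  case (LetIn env a u s b v t)
  from LetIn.prems obtain u' s' w' r' where *: "eval P env a u' s'" "eval P (u' # env) b v' r'"
    "t' = s' + r' + vsize v'" by (auto elim: eval_elims(9))
  with LetIn.IH(2)[OF *(1)] LetIn.IH(4) show ?case by auto
next
  case (Call f env as us s v t)
  from Call.prems obtain us' s' r' where *: "evals P env as us' s'" "eval P us' (P ! f) v' r'"
    "t' = s' + r' + vsize v'" by (auto elim: eval_elims(10))
  with Call.IH(3)[OF *(1)] Call.IH(5) show ?case by auto
next
  case (Nil env) from Nil.prems show ?case by (auto elim: eval_elims(11))
next
  case (Cons env a u s as us t)
  from Cons.prems show ?case by (rule eval_elims(12)) (auto dest: Cons.IH(2,4))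
qed

text \<open>A program is run by calling its first function on the input.\<close>

definition runs_to :: "prog \<Rightarrow> val \<Rightarrow> val \<Rightarrow> nat \<Rightarrow> bool" where
  "runs_to P x y t \<longleftrightarrow> eval P [x] (Call 0 [Var 0]) y t"


section \<open>Encodings and approximation algorithms\<close>

fun list_val :: "val list \<Rightarrow> val" where
  "list_val [] = Num 0"
| "list_val (x # xs) = Pair x (list_val xs)"

text \<open>Nonnegative rationals are encoded by numerator and denominator in lowest terms.\<close>

definition rat_val :: "rat \<Rightarrow> val" where
  "rat_val q = Pair (Num (nat (fst (quotient_of q)))) (Num (nat (snd (quotient_of q))))"

definition pair_edge :: "'v \<times> 'v \<Rightarrow> 'v set" where
  "pair_edge p = {fst p, snd p}"

text \<open>
  An instance is given by its vertices with their degree bounds and its edges with their costs;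
  vertices and edges may be listed in any order, and the ends of an edge in either order.
\<close>

definition encodes_instance :: "val \<Rightarrow> nat mpemc \<Rightarrow> bool" where
  "encodes_instance x I \<longleftrightarrow>
     (\<exists>vs ps. distinct vs \<and> set vs = verts I \<and>
        distinct (map pair_edge ps) \<and> pair_edge ` set ps = edges I \<and>
        x = Pair
          (list_val (map (\<lambda>v. Pair (Num v) (Num (req I v))) vs))
          (list_val (map (\<lambda>(u, v). Pair (Pair (Num u) (Num v)) (rat_val (cost I {u, v}))) ps)))"

definition encodes_edges :: "val \<Rightarrow> nat set set \<Rightarrow> bool" where
  "encodes_edges y J \<longleftrightarrow>
     (\<exists>ps. pair_edge ` set ps = J \<and> y = list_val (map (\<lambda>(u, v). Pair (Num u) (Num v)) ps))"

definition polytime_on_instances :: "prog \<Rightarrow> bool" where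
  "polytime_on_instances A \<longleftrightarrow>
     (\<exists>p :: nat poly. \<forall>I x. mpemc_instance I \<and> encodes_instance x I \<longrightarrow>
        (\<exists>y t. runs_to A x y t \<and> t \<le> poly p (vsize x)))"

text \<open>
  The ratio may depend on the maximum degree bound. Nothing is demanded of the output on instances
  without any feasible solution.
\<close>

definition mpemc_approximation_algorithm :: "prog \<Rightarrow> (nat \<Rightarrow> real) \<Rightarrow> bool" where
  "mpemc_approximation_algorithm A \<rho> \<longleftrightarrow>
     polytime_on_instances A \<and>
     (\<forall>I x. mpemc_instance I \<and> encodes_instance x I \<and> (\<exists>J. edge_cover_of I J) \<longrightarrow>
        (\<exists>y t J. runs_to A x y t \<and> encodes_edges y J \<and> edge_cover_of I J \<and>
           of_rat (power_of (cost I) J (verts I)) \<le> \<rho> (max_req I) * of_rat (opt_power I)))"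

end

theory Submission
  imports Defs
begin

text \<open>
  Scale the costs to integers and let \<open>w a\<close> be the cost of the \<open>r a\<close>-th cheapest edge at \<open>a\<close>, so that
  the sum of \<open>w\<close> is a lower bound on the optimum \<open>\<tau>\<close>. Serving \<open>a\<close> by its neighbour \<open>b\<close> is an arc from
  \<open>a\<close> to \<open>b\<close>. Measure the residual demand of a set of arcs by the weighted sum \<open>W\<close> of
  \<open>residual a * w a\<close>, which is at most \<open>k * \<tau>\<close> initially. A phase with parameter \<open>d\<close> allows only arcs
  from \<open>a\<close> of cost at most \<open>residual a * w a / d\<close>, which bounds the power at their tails by \<open>W / d\<close>,
  and picks a star of arcs into \<open>b\<close> of power \<open>l\<close> whenever it decreases \<open>W\<close> by at least \<open>d * l\<close>,
  which bounds the power at the heads by \<open>W / d\<close> as well. When no star of this density is left, the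
  stars of an optimal solution show that \<open>W \<le> 2 * d * \<tau>\<close>: vertices with a forbidden optimal arc
  contribute at most \<open>d * \<tau>\<close>, and so do the remaining ones. Halving \<open>d\<close> from \<open>k\<close> down to \<open>1\<close>, every
  phase costs at most \<open>12 * \<tau>\<close>, and after the phase with \<open>d = 1\<close> nothing is left to serve, since
  the \<open>r a\<close> cheapest arcs from \<open>a\<close> are always allowed.

  Polynomial time is obtained compositionally: the functions computable in polynomial time are
  closed under composition and under folds over lists whose state stays polynomially bounded.
\<close>

section \<open>Functions computable in polynomial time\<close>

lemma poly_nat_mono: "m \<le> n \<Longrightarrow> poly p m \<le> poly (p :: nat poly) n"
  by (induction p) (auto intro!: mult_mono)

text \<open>Every rule charges the size of its result, so a bound on the cost is also a bound on the
  size of the output.\<close>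

lemma eval_size: "eval P env e v t \<Longrightarrow> vsize v \<le> t"
  by (erule eval.cases) auto

section \<open>Encodings of data and their bit sizes\<close>

class encodable =
  fixes enc :: "'a \<Rightarrow> val"

definition sz :: "'a::encodable \<Rightarrow> nat" where
  "sz x = vsize (enc x)"

instantiation nat :: encodable
begin
definition enc_nat where "enc_nat = Num"
instance ..
end

instantiation bool :: encodable
begin
definition enc_bool where "enc_bool b = Num (if b then 1 else 0)"
instance ..
end

instantiation prod :: (encodable, encodable) encodable
begin
definition enc_prod where "enc_prod p = Pair (enc (fst p)) (enc (snd p))"
instance ..
end

instantiation list :: (encodable) encodable
begin
definition enc_list where "enc_list xs = list_val (map enc xs)"
instance ..
end

lemma enc_Pair [simp]: "enc (x, y) = Pair (enc x) (enc y)"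
  by (simp add: enc_prod_def)

lemma enc_Nil [simp]: "enc [] = Num 0"
  by (simp add: enc_list_def)

lemma enc_Cons [simp]: "enc (x # xs) = Pair (enc x) (enc xs)"
  by (simp add: enc_list_def)

lemma sz_Pair [simp]: "sz (x, y) = 1 + sz x + sz y"
  by (simp add: sz_def)

lemma sz_Nil [simp]: "sz [] = 1"
  by (simp add: sz_def floorlog_def)

lemma sz_Cons [simp]: "sz (x # xs) = 1 + sz x + sz xs"
  by (simp add: sz_def)

lemma sz_nat: "sz n = 1 + floorlog 2 n"
  by (simp add: sz_def enc_nat_def)

lemma length_le_sz: "length xs < sz xs"
  by (induction xs) auto

lemma sz_mem: "x \<in> set xs \<Longrightarrow> sz x \<le> sz xs"
  by (induction xs) auto

lemma sz_append: "sz (xs @ ys) \<le> sz xs + sz ys"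
  by (induction xs) auto

lemma sz_filter: "sz (filter P xs) \<le> sz xs"
  by (induction xs) auto

lemma sz_nat_mono: "m \<le> n \<Longrightarrow> sz (m :: nat) \<le> sz n"
  by (simp add: sz_nat floorlog_mono)

lemma floorlog_le_powerI: "n < 2 ^ k \<Longrightarrow> floorlog 2 n \<le> k"
  by (cases "n = 0") (auto simp: floorlog_leD floorlog_le_iff)

lemma less_power_floorlog: "n < 2 ^ floorlog 2 n"
  by (cases "n = 0") (auto simp: floorlog_bounds)

lemma sz_add: "sz (m + n :: nat) \<le> sz m + sz n"
proof -
  have "m + n < 2 ^ floorlog 2 m + 2 ^ floorlog 2 n"
    by (intro add_strict_mono less_power_floorlog)
  also have "\<dots> \<le> 2 ^ (floorlog 2 m + floorlog 2 n) + 2 ^ (floorlog 2 m + floorlog 2 n)"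
    by (intro add_mono power_increasing) auto
  also have "\<dots> = 2 ^ (1 + floorlog 2 m + floorlog 2 n)" by simp
  finally have "floorlog 2 (m + n) \<le> 1 + floorlog 2 m + floorlog 2 n"
    by (rule floorlog_le_powerI)
  \<comment> \<open>\<open>sz\<close> exceeds the number of digits by one, so
    \<open>sz m + sz n\<close> has room for the carry.\<close>
  then show ?thesis by (simp add: sz_nat)
qed

lemma sz_mult: "sz (m * n :: nat) \<le> sz m + sz n"
proof -
  have "m * n < 2 ^ floorlog 2 m * 2 ^ floorlog 2 n"
    by (intro mult_strict_mono less_power_floorlog) auto
  also have "\<dots> = 2 ^ (floorlog 2 m + floorlog 2 n)" by (simp add: power_add)
  finally have "floorlog 2 (m * n) \<le> floorlog 2 m + floorlog 2 n"
    by (rule floorlog_le_powerI)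
  then show ?thesis by (simp add: sz_nat)
qed

lemma sz_max: "sz (max m n :: nat) \<le> sz m + sz n"
  by (simp add: max_def)

section \<open>Linkable code and its running time\<close>

text \<open>
  Quantifying over the surrounding code \<open>P0\<close>, \<open>Q\<close> and the outer environment \<open>env\<close> makes code
  fragments linkable without renumbering calls or variables.
\<close>

definition implements ::
    "nat \<Rightarrow> prog \<Rightarrow> expr \<Rightarrow> ('a::encodable \<Rightarrow> 'b::encodable) \<Rightarrow> nat poly \<Rightarrow> bool" where
  "implements n P e f p \<longleftrightarrow> (\<forall>P0 Q env x. length P0 = n \<longrightarrow>
     (\<exists>t\<le>poly p (sz x). eval (P0 @ P @ Q) (enc x # env) e (enc (f x)) t))"

text \<open>Calls refer to absolute positions in the program, so the code depends on the offset
  \<open>n\<close>; the bound \<open>p\<close> does not.\<close>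

definition ptime :: "('a::encodable \<Rightarrow> 'b::encodable) \<Rightarrow> bool" where
  "ptime f \<longleftrightarrow> (\<exists>p. \<forall>n. \<exists>P e. implements n P e f p)"

lemma ptimeE:
  assumes "ptime f"
  obtains p where "\<And>n. \<exists>P e. implements n P e f p"
  using assms unfolding ptime_def by blast

lemma implements_appendL: "implements n P e f p \<Longrightarrow> implements n (P @ P') e f p"
  unfolding implements_def by (metis append.assoc)

lemma implements_appendR:
  assumes "implements (n + length P') P e f p"
  shows "implements n (P' @ P) e f p"
  unfolding implements_def
proof (intro allI impI)
  fix P0 Q env x assume "length (P0 :: prog) = n"
  then have "length (P0 @ P') = n + length P'" by simp
  with assms show "\<exists>t\<le>poly p (sz x). eval (P0 @ (P' @ P) @ Q) (enc x # env) e (enc (f x)) t"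
    unfolding implements_def by (metis append.assoc)
qed

lemma implementsD:
  assumes "implements n P e f p" "length P0 = n"
  obtains t where "t \<le> poly p (sz x)" "eval (P0 @ P @ Q) (enc x # env) e (enc (f x)) t"
  using assms unfolding implements_def by blast

lemma ptime_size:
  assumes "ptime f"
  obtains p where "\<And>x. sz (f x) \<le> poly p (sz x)"
proof -
  from assms obtain p where p: "\<forall>n. \<exists>P e. implements n P e f p" unfolding ptime_def by blast
  then obtain P e where "implements 0 P e f p" by blast
  then have "sz (f x) \<le> poly p (sz x)" for x
    unfolding sz_def by (metis eval_size implementsD le_trans list.size(3) sz_def)
  then show ?thesis using that by blast
qed

text \<open>The code of the three parts is laid out consecutively, each compiled for the offset at
  which it lands, and the new bound is a composition of polynomials. The closure rules for pairing,
  projections, arithmetic and branching reduce to single evaluation rules in this way.\<close>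

lemma ptime_lift3:
  fixes f :: "'a::encodable \<Rightarrow> 'b::encodable" and g :: "'a \<Rightarrow> 'c::encodable"
    and h :: "'a \<Rightarrow> 'd::encodable" and k :: "'a \<Rightarrow> 'e::encodable"
  assumes "ptime f" "ptime g" "ptime h"
    and step: "\<And>P env x e1 e2 e3 t1 t2 t3. eval P (enc x # env) e1 (enc (f x)) t1 \<Longrightarrow>
      eval P (enc x # env) e2 (enc (g x)) t2 \<Longrightarrow> eval P (enc x # env) e3 (enc (h x)) t3 \<Longrightarrow>
      \<exists>t\<le>poly q (t1 + t2 + t3). eval P (enc x # env) (mk e1 e2 e3) (enc (k x)) t"
  shows "ptime k"
proof -
  obtain p1 p2 p3 where p: "\<And>n. \<exists>P e. implements n P e f p1" "\<And>n. \<exists>P e. implements n P e g p2"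
    "\<And>n. \<exists>P e. implements n P e h p3"
    using assms(1-3) unfolding ptime_def by metis
  have "\<exists>P e. implements n P e k (pcompose q (p1 + p2 + p3))" for n
  proof -
    obtain P1 e1 where 1: "implements n P1 e1 f p1" using p(1) by blast
    obtain P2 e2 where 2: "implements (n + length P1) P2 e2 g p2" using p(2) by blast
    obtain P3 e3 where 3: "implements (n + length (P1 @ P2)) P3 e3 h p3" using p(3) by blast
    let ?P = "(P1 @ P2) @ P3"
    have i: "implements n ?P e1 f p1" "implements n ?P e2 g p2" "implements n ?P e3 h p3"
      using 1 2 3 by (auto intro: implements_appendL implements_appendR simp del: append_assoc)
    have "implements n ?P (mk e1 e2 e3) k (pcompose q (p1 + p2 + p3))"
      unfolding implements_def
    proof (intro allI impI)
      fix P0 Q env and x :: 'a assume n: "length (P0 :: prog) = n"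
      obtain t1 where t1: "t1 \<le> poly p1 (sz x)" "eval (P0 @ ?P @ Q) (enc x # env) e1 (enc (f x)) t1"
        by (rule implementsD[OF i(1) n])
      obtain t2 where t2: "t2 \<le> poly p2 (sz x)" "eval (P0 @ ?P @ Q) (enc x # env) e2 (enc (g x)) t2"
        by (rule implementsD[OF i(2) n])
      obtain t3 where t3: "t3 \<le> poly p3 (sz x)" "eval (P0 @ ?P @ Q) (enc x # env) e3 (enc (h x)) t3"
        by (rule implementsD[OF i(3) n])
      obtain t where t: "t \<le> poly q (t1 + t2 + t3)"
        "eval (P0 @ ?P @ Q) (enc x # env) (mk e1 e2 e3) (enc (k x)) t"
        using step[OF t1(2) t2(2) t3(2)] by blast
      have "poly q (t1 + t2 + t3) \<le> poly q (poly p1 (sz x) + poly p2 (sz x) + poly p3 (sz x))"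
        using t1(1) t2(1) t3(1) by (intro poly_nat_mono add_mono)
      with t show "\<exists>t\<le>poly (pcompose q (p1 + p2 + p3)) (sz x).
          eval (P0 @ ?P @ Q) (enc x # env) (mk e1 e2 e3) (enc (k x)) t"
        by (intro exI[of _ t]) (simp add: poly_pcompose)
    qed
    then show ?thesis by blast
  qed
  then show ?thesis unfolding ptime_def by blast
qed

lemma ptime_lift2:
  assumes "ptime f" "ptime g"
    and "\<And>P env x e1 e2 t1 t2. eval P (enc x # env) e1 (enc (f x)) t1 \<Longrightarrow>
      eval P (enc x # env) e2 (enc (g x)) t2 \<Longrightarrow>
      \<exists>t\<le>poly q (t1 + t2). eval P (enc x # env) (mk e1 e2) (enc (k x)) t"
  shows "ptime k"
proof (rule ptime_lift3[OF assms(1,2,2)])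
  fix P env x e1 e2 e3 t1 t2 t3
  assume "eval P (enc x # env) e1 (enc (f x)) t1" "eval P (enc x # env) e2 (enc (g x)) t2"
  from assms(3)[OF this] obtain t where
    t: "t \<le> poly q (t1 + t2)" "eval P (enc x # env) (mk e1 e2) (enc (k x)) t" by blast
  moreover have "poly q (t1 + t2) \<le> poly q (t1 + t2 + t3)" by (intro poly_nat_mono) simp
  ultimately show "\<exists>t\<le>poly q (t1 + t2 + t3). eval P (enc x # env) ((\<lambda>e1 e2 e3. mk e1 e2) e1 e2 e3) (enc (k x)) t"
    by (intro exI[of _ t]) auto
qed

lemma ptime_lift1:
  assumes "ptime f"
    and "\<And>P env x e1 t1. eval P (enc x # env) e1 (enc (f x)) t1 \<Longrightarrow>
      \<exists>t\<le>poly q t1. eval P (enc x # env) (mk e1) (enc (k x)) t"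
  shows "ptime k"
proof (rule ptime_lift2[OF assms(1,1)])
  fix P env x e1 e2 t1 t2
  assume "eval P (enc x # env) e1 (enc (f x)) t1"
  from assms(2)[OF this] obtain t where
    t: "t \<le> poly q t1" "eval P (enc x # env) (mk e1) (enc (k x)) t" by blast
  moreover have "poly q t1 \<le> poly q (t1 + t2)" by (intro poly_nat_mono) simp
  ultimately show "\<exists>t\<le>poly q (t1 + t2). eval P (enc x # env) ((\<lambda>e1 e2. mk e1) e1 e2) (enc (k x)) t"
    by (intro exI[of _ t]) auto
qed

section \<open>Closure under basic operations and composition\<close>

named_theorems ptime_intros

lemma ptime_id [ptime_intros]: "ptime (\<lambda>x. x)"
proof -
  have "implements n [] (Var 0) (\<lambda>x. x) [:0, 1:]" for n
    unfolding implements_def using eval_evals.Var[of 0 "enc x # env" for x env]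
    by (fastforce simp: sz_def)
  then show ?thesis unfolding ptime_def by blast
qed

lemma ptime_numI:
  assumes "\<And>x. enc (f x) = Num m"
  shows "ptime f"
proof -
  have "implements n [] (Lit m) f [:vsize (Num m):]" for n
    unfolding implements_def using eval_evals.Lit assms
    by (auto intro!: exI[of _ "vsize (Num m)"])
  then show ?thesis unfolding ptime_def by blast
qed

lemma ptime_const [ptime_intros]: "ptime (\<lambda>x. n :: nat)"
  by (rule ptime_numI[of _ n]) (simp add: enc_nat_def)

lemma ptime_False [ptime_intros]: "ptime (\<lambda>x. False)"
  by (rule ptime_numI[of _ 0]) (simp add: enc_bool_def)

lemma ptime_True [ptime_intros]: "ptime (\<lambda>x. True)"
  by (rule ptime_numI[of _ 1]) (simp add: enc_bool_def)

lemma ptime_Nil [ptime_intros]: "ptime (\<lambda>x. [] :: 'a::encodable list)"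
  by (rule ptime_numI[of _ 0]) simp

lemma ptime_mkpair:
  assumes "ptime f" "ptime g" "\<And>x. enc (k x) = Pair (enc (f x)) (enc (g x))"
  shows "ptime k"
\<comment> \<open>The sizes of the parts are bounded by their costs, so building the pair at most
  doubles the cost, up to one.\<close>
proof (rule ptime_lift2[OF assms(1,2), where q = "[:1, 2:]"])
  fix P env x e1 e2 t1 t2
  assume e: "eval P (enc x # env) e1 (enc (f x)) t1" "eval P (enc x # env) e2 (enc (g x)) t2"
  from eval_evals.MkPair[OF this] eval_size[OF e(1)] eval_size[OF e(2)]
  show "\<exists>t\<le>poly [:1, 2:] (t1 + t2). eval P (enc x # env) (MkPair e1 e2) (enc (k x)) t"
    by (intro exI[of _ "t1 + t2 + vsize (enc (k x))"]) (auto simp: assms(3))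
qed

lemma ptime_Pair [ptime_intros]: "ptime f \<Longrightarrow> ptime g \<Longrightarrow> ptime (\<lambda>x. (f x, g x))"
  by (rule ptime_mkpair) simp_all

lemma ptime_Cons [ptime_intros]: "ptime f \<Longrightarrow> ptime g \<Longrightarrow> ptime (\<lambda>x. f x # g x)"
  by (rule ptime_mkpair) simp_all

lemma ptime_fst [ptime_intros]:
  assumes "ptime f" shows "ptime (\<lambda>x. fst (f x))"
proof (rule ptime_lift1[OF assms, where q = "[:0, 2:]"])
  fix P env x e1 t1 assume e: "eval P (enc x # env) e1 (enc (f x)) t1"
  then have "eval P (enc x # env) (Fst e1) (enc (fst (f x))) (t1 + vsize (enc (fst (f x))))"
    by (intro eval_evals.Fst) (simp add: enc_prod_def)
  then show "\<exists>t\<le>poly [:0, 2:] t1. eval P (enc x # env) (Fst e1) (enc (fst (f x))) t"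
    using eval_size[OF e] by (intro exI conjI) (auto simp: enc_prod_def)
qed

lemma ptime_snd [ptime_intros]:
  assumes "ptime f" shows "ptime (\<lambda>x. snd (f x))"
proof (rule ptime_lift1[OF assms, where q = "[:0, 2:]"])
  fix P env x e1 t1 assume e: "eval P (enc x # env) e1 (enc (f x)) t1"
  then have "eval P (enc x # env) (Snd e1) (enc (snd (f x))) (t1 + vsize (enc (snd (f x))))"
    by (intro eval_evals.Snd) (simp add: enc_prod_def)
  then show "\<exists>t\<le>poly [:0, 2:] t1. eval P (enc x # env) (Snd e1) (enc (snd (f x))) t"
    using eval_size[OF e] by (intro exI conjI) (auto simp: enc_prod_def)
qed

lemma ptime_binop:
  assumes "ptime f" "ptime g"
    and "\<And>x. enc (k x) = Num (binop_sem b (f x) (g x))"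
    and "\<And>x. sz (binop_sem b (f x) (g x)) \<le> 1 + sz (f x) + sz (g x)"
  shows "ptime k"
proof (rule ptime_lift2[OF assms(1,2), where q = "[:1, 2:]"])
  fix P env x e1 e2 t1 t2
  assume e: "eval P (enc x # env) e1 (enc (f x)) t1" "eval P (enc x # env) e2 (enc (g x)) t2"
  from eval_evals.Bin[OF e[unfolded enc_nat_def], of b] eval_size[OF e(1)] eval_size[OF e(2)] assms(4)[of x]
  show "\<exists>t\<le>poly [:1, 2:] (t1 + t2). eval P (enc x # env) (Bin b e1 e2) (enc (k x)) t"
    by (intro exI conjI, simp only: assms(3)) (auto simp: sz_def enc_nat_def assms(3))
qed

lemma ptime_add [ptime_intros]: "ptime f \<Longrightarrow> ptime g \<Longrightarrow> ptime (\<lambda>x. f x + g x :: nat)"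
  by (rule ptime_binop[of f g _ Plus]) (auto simp: enc_nat_def intro: le_SucI sz_add)

lemma ptime_mult [ptime_intros]: "ptime f \<Longrightarrow> ptime g \<Longrightarrow> ptime (\<lambda>x. f x * g x :: nat)"
  by (rule ptime_binop[of f g _ Times]) (auto simp: enc_nat_def intro: le_SucI sz_mult)

lemma ptime_diff [ptime_intros]: "ptime f \<Longrightarrow> ptime g \<Longrightarrow> ptime (\<lambda>x. f x - g x :: nat)"
  by (rule ptime_binop[of f g _ Minus])
    (auto simp: enc_nat_def intro!: trans_le_add1 le_SucI sz_nat_mono)

lemma ptime_div [ptime_intros]: "ptime f \<Longrightarrow> ptime g \<Longrightarrow> ptime (\<lambda>x. f x div g x :: nat)"
  by (rule ptime_binop[of f g _ Div])
    (auto simp: enc_nat_def intro!: trans_le_add1 le_SucI sz_nat_mono)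

lemma ptime_le [ptime_intros]: "ptime f \<Longrightarrow> ptime g \<Longrightarrow> ptime (\<lambda>x. f x \<le> (g x :: nat))"
  by (rule ptime_binop[of f g _ Leq]) (auto simp: enc_bool_def sz_nat floorlog_def)

lemma ptime_if [ptime_intros]:
  assumes "ptime c" "ptime f" "ptime g"
  shows "ptime (\<lambda>x. if c x then f x else g x)"
proof (rule ptime_lift3[OF assms, where q = "[:0, 2:]"])
  fix P env x e1 e2 e3 t1 t2 t3
  assume e: "eval P (enc x # env) e1 (enc (c x)) t1" "eval P (enc x # env) e2 (enc (f x)) t2"
    "eval P (enc x # env) e3 (enc (g x)) t3"
  show "\<exists>t\<le>poly [:0, 2:] (t1 + t2 + t3). eval P (enc x # env) (IfNZ e1 e2 e3)
    (enc (if c x then f x else g x)) t"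
  proof (cases "c x")
    case True
    with e(1) have "eval P (enc x # env) e1 (Num 1) t1" by (simp add: enc_bool_def)
    from eval_evals.IfNZ_True[OF this _ e(2), of e3] True eval_size[OF e(2)] show ?thesis
      by (intro exI[of _ "t1 + t2 + vsize (enc (f x))"]) auto
  next
    case False
    with e(1) have "eval P (enc x # env) e1 (Num 0) t1" by (simp add: enc_bool_def)
    from eval_evals.IfNZ_False[OF this e(3), of e2] False eval_size[OF e(3)] show ?thesis
      by (intro exI[of _ "t1 + t3 + vsize (enc (g x))"]) auto
  qed
qed

lemma ptime_not [ptime_intros]:
  assumes "ptime c" shows "ptime (\<lambda>x. \<not> c x)"
proof -
  have "(\<lambda>x. \<not> c x) = (\<lambda>x. if c x then False else True)" by auto
  then show ?thesis using assms by (simp only:) (intro ptime_intros)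
qed

lemma ptime_conj [ptime_intros]:
  assumes "ptime c" "ptime d" shows "ptime (\<lambda>x. c x \<and> d x)"
proof -
  have "(\<lambda>x. c x \<and> d x) = (\<lambda>x. if c x then d x else False)" by auto
  then show ?thesis using assms by (simp only:) (intro ptime_intros)
qed

lemma ptime_less [ptime_intros]: "ptime f \<Longrightarrow> ptime g \<Longrightarrow> ptime (\<lambda>x. f x < (g x :: nat))"
  by (simp only: not_le[symmetric]) (intro ptime_intros)

lemma ptime_eq_nat [ptime_intros]: "ptime f \<Longrightarrow> ptime g \<Longrightarrow> ptime (\<lambda>x. f x = (g x :: nat))"
  by (simp only: order_eq_iff) (intro ptime_intros)

lemma ptime_max [ptime_intros]: "ptime f \<Longrightarrow> ptime g \<Longrightarrow> ptime (\<lambda>x. max (f x) (g x :: nat))"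
  by (simp only: max_def) (intro ptime_intros)

lemma ptime_compose:
  fixes f :: "'b::encodable \<Rightarrow> 'c::encodable" and g :: "'a::encodable \<Rightarrow> 'b"
  assumes "ptime f" "ptime g"
  shows "ptime (\<lambda>x. f (g x))"
proof -
  obtain p1 p2 where p: "\<And>n. \<exists>P e. implements n P e f p1" "\<And>n. \<exists>P e. implements n P e g p2"
    using assms unfolding ptime_def by metis
  have "\<exists>P e. implements n P e (\<lambda>x. f (g x)) (p2 + smult 2 (pcompose p1 p2))" for n
  proof -
    obtain P1 e1 where 1: "implements n P1 e1 f p1" using p(1) by blast
    obtain P2 e2 where 2: "implements (n + length P1) P2 e2 g p2" using p(2) by blast
    let ?P = "P1 @ P2"
    have i: "implements n ?P e1 f p1" "implements n ?P e2 g p2"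
      using 1 2 by (auto intro: implements_appendL implements_appendR)
    \<comment> \<open>\<open>LetIn\<close> puts \<open>g x\<close> in front of the environment, and
      the code for \<open>f\<close> tolerates the old environment behind it. The factor 2 pays for
      the result once more.\<close>
    have "implements n ?P (LetIn e2 e1) (\<lambda>x. f (g x)) (p2 + smult 2 (pcompose p1 p2))"
      unfolding implements_def
    proof (intro allI impI)
      fix P0 Q env and x :: 'a assume n: "length (P0 :: prog) = n"
      obtain t2 where t2: "t2 \<le> poly p2 (sz x)" "eval (P0 @ ?P @ Q) (enc x # env) e2 (enc (g x)) t2"
        by (rule implementsD[OF i(2) n])
      obtain t1 where t1: "t1 \<le> poly p1 (sz (g x))"
        "eval (P0 @ ?P @ Q) (enc (g x) # enc x # env) e1 (enc (f (g x))) t1"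
        by (rule implementsD[OF i(1) n])
      have "sz (g x) \<le> poly p2 (sz x)" using eval_size[OF t2(2)] t2(1) by (simp add: sz_def)
      then have "t1 \<le> poly p1 (poly p2 (sz x))"
        using t1(1) poly_nat_mono le_trans by blast
      then show "\<exists>t\<le>poly (p2 + smult 2 (pcompose p1 p2)) (sz x).
          eval (P0 @ ?P @ Q) (enc x # env) (LetIn e2 e1) (enc (f (g x))) t"
        using eval_evals.LetIn[OF t2(2) t1(2)] t2(1) eval_size[OF t1(2)]
        by (intro exI conjI) (auto simp: poly_pcompose)
    qed
    then show ?thesis by blast
  qed
  then show ?thesis unfolding ptime_def by blast
qed


section \<open>Folds over lists\<close>

definition fold_body :: "nat \<Rightarrow> expr \<Rightarrow> expr" where
  "fold_body m e = IfNZ (IsPair (Var 0))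
     (Call m [Snd (Var 0), LetIn (MkPair (Var 2) (MkPair (Var 1) (Fst (Var 0)))) e, Var 2])
     (Var 1)"

text \<open>The environment of the folding function holds the remaining list, the state and the
  parameter; \<open>e\<close> finds the triple of parameter, state and next element as its first
  variable, of size at most \<open>2 + sz x + B + L\<close>. One level copies these values a
  constant number of times, whence the coefficients. It also returns the final state, so
  \<open>B\<close> bounds the last state along with the intermediate ones.\<close>

lemma eval_fold_body:
  fixes h :: "'a::encodable \<Rightarrow> 's::encodable \<Rightarrow> 'b::encodable \<Rightarrow> 's"
  assumes m: "m < length Pr" "Pr ! m = fold_body m e"
    and h: "\<And>z env. \<exists>t\<le>poly p (sz z).
      eval Pr (enc z # env) e (enc (h (fst z) (fst (snd z)) (snd (snd z)))) t"
    and B: "\<And>n. sz (foldl (h x) s (take n ys)) \<le> B" and L: "sz ys \<le> L"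
  shows "\<exists>t\<le>(length ys + 1) * (7 * L + 3 * sz x + 6 * B + poly p (2 + sz x + B + L) + 6).
    eval Pr [enc ys, enc s, enc x] (fold_body m e) (enc (foldl (h x) s ys)) t"
  using B L
proof (induction ys arbitrary: s)
  case Nil
  let ?env = "[enc ([] :: 'b list), enc s, enc x]"
  have "eval Pr ?env (IsPair (Var 0)) (Num 0) (vsize (Num 0) + vsize (Num 0))"
    using eval_evals.Var[of 0 ?env Pr] by (intro eval_evals.IsPair_Num) simp
  moreover have "eval Pr ?env (Var 1) (enc s) (sz s)"
    using eval_evals.Var[of 1 ?env Pr] by (simp add: sz_def)
  ultimately have "eval Pr ?env (fold_body m e) (enc s) (vsize (Num 0) + vsize (Num 0) + sz s + vsize (enc s))"
    unfolding fold_body_def by (rule eval_evals.IfNZ_False)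
  moreover have "sz s \<le> B" using Nil.prems(1)[of 0] by simp
  ultimately show ?case by (intro exI conjI) (auto simp: sz_def floorlog_def)
next
  case (Cons y ys)
  let ?env = "[enc (y # ys), enc s, enc x]" and ?s' = "h x s y"
  let ?v = "enc (foldl (h x) s (y # ys))" and ?H = "poly p (2 + sz x + B + L)"
  have bounds: "sz s \<le> B" "sz ?s' \<le> B" "sz y + sz ys < L" "vsize ?v \<le> B"
    using Cons.prems(1)[of 0] Cons.prems(1)[of 1] Cons.prems(1)[of "length (y # ys)"] Cons.prems(2)
    by (auto simp: sz_def)
  have "eval Pr ?env (Var 0) (Pair (enc y) (enc ys)) (sz (y # ys))"
    using eval_evals.Var[of 0 ?env Pr] by (simp add: sz_def)
  note v0 = this
  have v1: "eval Pr ?env (Var 1) (enc s) (sz s)" and v2: "eval Pr ?env (Var 2) (enc x) (sz x)"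
    using eval_evals.Var[of 1 ?env Pr] eval_evals.Var[of 2 ?env Pr] by (auto simp: sz_def)
  note pr = eval_evals.MkPair[OF v2 eval_evals.MkPair[OF v1 eval_evals.Fst[OF v0]]]
  obtain th where th: "th \<le> poly p (sz (x, s, y))"
    "eval Pr (enc (x, s, y) # ?env) e (enc ?s') th"
    using h[of "(x, s, y)" ?env] by auto
  have "poly p (sz (x, s, y)) \<le> ?H"
    using bounds by (intro poly_nat_mono) simp
  with th have th': "th \<le> ?H" by simp
  note lt = eval_evals.LetIn[OF pr th(2)[unfolded enc_Pair]]
  note args = eval_evals.Cons[OF eval_evals.Snd[OF v0] eval_evals.Cons[OF lt
    eval_evals.Cons[OF v2 eval_evals.Nil]]]
  have "sz (foldl (h x) ?s' (take n ys)) \<le> B" for n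
    using Cons.prems(1)[of "Suc n"] by simp
  then obtain t where t: "t \<le> (length ys + 1) * (7 * L + 3 * sz x + 6 * B + ?H + 6)"
    "eval Pr [enc ys, enc ?s', enc x] (fold_body m e) (enc (foldl (h x) ?s' ys)) t"
    using Cons.IH[of ?s'] bounds by auto
  note call = eval_evals.Call[OF m(1) args t(2)[folded m(2)]]
  note res = eval_evals.IfNZ_True[OF eval_evals.IsPair_Pair[OF v0] _ call, of "Var 1"]
  show ?case
    unfolding fold_body_def
    apply (intro exI conjI)
     prefer 2 apply (simp only: foldl.simps) apply (rule res, simp)
    using t(1) th' bounds
    apply (simp add: sz_def floorlog_def)
    done
qed

lemma ptime_foldl_bounded:
  fixes h :: "'a::encodable \<Rightarrow> 's::encodable \<Rightarrow> 'b::encodable \<Rightarrow> 's"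
  assumes h: "ptime (\<lambda>z. h (fst z) (fst (snd z)) (snd (snd z)))"
    and l: "ptime l" and i: "ptime i"
    and B: "\<And>x n. sz (foldl (h x) (i x) (take n (l x))) \<le> poly q (sz x)"
  shows "ptime (\<lambda>x. foldl (h x) (i x) (l x))"
proof -
  let ?h = "\<lambda>z. h (fst z) (fst (snd z)) (snd (snd z))"
  obtain ph where p1: "\<And>n. \<exists>P e. implements n P e ?h ph" using ptimeE[OF h] by blast
  obtain pl where p2: "\<And>n. \<exists>P e. implements n P e l pl" using ptimeE[OF l] by blast
  obtain pi' where p3: "\<And>n. \<exists>P e. implements n P e i pi'" using ptimeE[OF i] by blast
  note p = p1 p2 p3
  \<comment> \<open>The summands pay for the list, the initial state, reading the argument, all
    levels of the recursion, and the result.\<close>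
  define r where "r = pl + pi' + [:0, 1:] + (pl + 1) *
    (smult 7 pl + smult 3 [:0, 1:] + smult 6 q + pcompose ph ([:2, 1:] + q + pl) + [:6:]) + q"
  have "\<exists>P e. implements n P e (\<lambda>x. foldl (h x) (i x) (l x)) r" for n
  proof -
    obtain P1 e1 where 1: "implements n P1 e1 l pl" using p(2) by blast
    obtain P2 e2 where 2: "implements (n + length P1) P2 e2 i pi'" using p(3) by blast
    \<comment> \<open>The position of the folding function, which has to call itself; the code of
      the step follows at \<open>Suc m\<close>.\<close>
    define m where "m = n + length (P1 @ P2)"
    obtain P3 e3 where 3: "implements (Suc m) P3 e3 ?h ph" using p(1) by blast
    define P where "P = (P1 @ P2) @ [fold_body m e3] @ P3"
    have "implements n ((P1 @ P2) @ ([fold_body m e3] @ P3)) e3 ?h ph"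
      using 3 by (intro implements_appendR) (simp add: m_def)
    then have i: "implements n P e1 l pl" "implements n P e2 i pi'" "implements n P e3 ?h ph"
      using 1 2 by (auto simp: P_def intro: implements_appendL implements_appendR simp del: append_assoc)
    have "implements n P (Call m [e1, e2, Var 0]) (\<lambda>x. foldl (h x) (i x) (l x)) r"
      unfolding implements_def
    proof (intro allI impI)
      fix P0 Q env and x :: 'a assume n: "length (P0 :: prog) = n"
      let ?Pr = "P0 @ P @ Q"
      obtain t1 where t1: "t1 \<le> poly pl (sz x)" "eval ?Pr (enc x # env) e1 (enc (l x)) t1"
        by (rule implementsD[OF i(1) n])
      obtain t2 where t2: "t2 \<le> poly pi' (sz x)" "eval ?Pr (enc x # env) e2 (enc (i x)) t2"
        by (rule implementsD[OF i(2) n])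
      have m: "m < length ?Pr" "?Pr ! m = fold_body m e3"
        using n by (auto simp: P_def m_def nth_append)
      have h': "\<exists>t\<le>poly ph (sz z). eval ?Pr (enc z # env) e3 (enc (?h z)) t" for z env
        using i(3) n unfolding implements_def by blast
      have L: "sz (l x) \<le> poly pl (sz x)" using eval_size[OF t1(2)] t1(1) by (simp add: sz_def)
      let ?C = "7 * poly pl (sz x) + 3 * sz x + 6 * poly q (sz x) +
        poly ph (2 + sz x + poly q (sz x) + poly pl (sz x)) + 6"
      obtain t where t: "t \<le> (length (l x) + 1) * ?C"
        "eval ?Pr [enc (l x), enc (i x), enc x] (fold_body m e3) (enc (foldl (h x) (i x) (l x))) t"
        using eval_fold_body[OF m h' B L] by blast
      have "length (l x) + 1 \<le> poly pl (sz x) + 1" using length_le_sz[of "l x"] L by simp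
      then have "(length (l x) + 1) * ?C \<le> (poly pl (sz x) + 1) * ?C" by (rule mult_le_mono1)
      with t(1) have t_le: "t \<le> (poly pl (sz x) + 1) * ?C" by (rule le_trans)
      have v: "eval ?Pr (enc x # env) (Var 0) (enc x) (sz x)"
        using eval_evals.Var[of 0 "enc x # env" ?Pr] by (simp add: sz_def)
      note args = eval_evals.Cons[OF t1(2) eval_evals.Cons[OF t2(2) eval_evals.Cons[OF v eval_evals.Nil]]]
      have r: "poly r (sz x) = poly pl (sz x) + poly pi' (sz x) + sz x + (poly pl (sz x) + 1) * ?C
          + poly q (sz x)"
        unfolding r_def by (simp only: poly_add poly_mult poly_smult poly_pcompose poly_pCons poly_0 poly_1
          mult_1_right mult_0_right add_0_left add_0_right one_add_one)
      have "sz (foldl (h x) (i x) (l x)) \<le> poly q (sz x)"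
        using B[of x "length (l x)"] by simp
      then have "t1 + (t2 + (sz x + 0)) + t + vsize (enc (foldl (h x) (i x) (l x))) \<le> poly r (sz x)"
        using t_le t1(1) t2(1) r unfolding sz_def[of "foldl (h x) (i x) (l x)"] by linarith
      with eval_evals.Call[OF m(1) args t(2)[folded m(2)]]
      show "\<exists>t\<le>poly r (sz x). eval ?Pr (enc x # env) (Call m [e1, e2, Var 0])
          (enc (foldl (h x) (i x) (l x))) t"
        by blast
    qed
    then show ?thesis by blast
  qed
  then show ?thesis unfolding ptime_def by blast
qed

text \<open>The increment may depend on the parameter and the list element but not on the state, so
  the increments add up to a polynomial; a state that doubles in every step would grow
  exponentially.\<close>

lemma ptime_foldl:
  fixes h :: "'a::encodable \<Rightarrow> 's::encodable \<Rightarrow> 'b::encodable \<Rightarrow> 's"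
  assumes h: "ptime (\<lambda>z. h (fst z) (fst (snd z)) (snd (snd z)))"
    and l: "ptime l" and i: "ptime i"
    and g: "\<And>x s y. sz (h x s y) \<le> sz s + poly g (sz x + sz y)"
  shows "ptime (\<lambda>x. foldl (h x) (i x) (l x))"
proof -
  obtain pl where pl: "\<And>x. sz (l x) \<le> poly pl (sz x)" using ptime_size[OF l] by blast
  obtain pi' where pi': "\<And>x. sz (i x) \<le> poly pi' (sz x)" using ptime_size[OF i] by blast
  have grow: "sz (foldl (h x) s ys) \<le> sz s + length ys * poly g (sz x + M)"
    if "\<And>y. y \<in> set ys \<Longrightarrow> sz y \<le> M" for x s ys M
    using that
  proof (induction ys arbitrary: s)
    case (Cons y ys)
    have "sz (foldl (h x) s (y # ys)) \<le> sz (h x s y) + length ys * poly g (sz x + M)"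
      using Cons by simp
    moreover have "sz (h x s y) \<le> sz s + poly g (sz x + M)"
      using g[of x s y] poly_nat_mono[of "sz x + sz y" "sz x + M" g] Cons.prems[of y] by force
    ultimately show ?case by simp
  qed simp
  have "sz (foldl (h x) (i x) (take n (l x))) \<le> poly (pi' + pl * pcompose g ([:0, 1:] + pl)) (sz x)"
    for x n
  proof -
    have "sz (foldl (h x) (i x) (take n (l x))) \<le>
        sz (i x) + length (take n (l x)) * poly g (sz x + poly pl (sz x))"
      by (rule grow) (metis in_set_takeD le_trans pl sz_mem)
    also have "\<dots> \<le> poly pi' (sz x) + poly pl (sz x) * poly g (sz x + poly pl (sz x))"
      using pi'[of x] length_le_sz[of "l x"] pl[of x] by (intro add_mono mult_le_mono1) auto
    finally show ?thesis by (simp add: poly_pcompose)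
  qed
  then show ?thesis by (rule ptime_foldl_bounded[OF h l i])
qed

lemma ptime_foldl0:
  fixes h :: "'a::encodable \<Rightarrow> 's::encodable \<Rightarrow> 'b::encodable \<Rightarrow> 's"
  assumes h: "ptime (\<lambda>z. h (fst z) (fst (snd z)) (snd (snd z)))"
    and l: "ptime l" and i: "ptime i"
    and f: "ptime (\<lambda>z. f (fst z) (snd z))"
    and g: "\<And>x s y. sz (h x s y) \<le> 1 + sz s + sz (f x y)"
  shows "ptime (\<lambda>x. foldl (h x) (i x) (l x))"
proof -
  obtain pf where pf: "\<And>z. sz (f (fst z) (snd z)) \<le> poly pf (sz z)" using ptime_size[OF f] by blast
  show ?thesis
  proof (rule ptime_foldl[OF h l i])
    fix x s y
    show "sz (h x s y) \<le> sz s + poly (1 + pcompose pf [:1, 1:]) (sz x + sz y)"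
      using g[of x s y] pf[of "(x, y)"] by (simp add: poly_pcompose add.assoc)
  qed
qed

section \<open>List operations expressed as folds\<close>

lemma sum_list_foldl: "foldl (\<lambda>s y. s + f y) a xs = a + sum_list (map f xs)"
  for a :: "'a::monoid_add"
  by (induction xs arbitrary: a) (auto simp: add.assoc)

lemma prod_list_foldl: "foldl (\<lambda>s y. s * f y) a xs = a * prod_list (map f xs)"
  for a :: "'a::monoid_mult"
  by (induction xs arbitrary: a) (auto simp: mult.assoc)

lemma append_foldl: "foldl (\<lambda>s y. y # s) zs xs = rev xs @ zs"
  by (induction xs arbitrary: zs) auto

lemma map_foldl: "foldl (\<lambda>s y. f y # s) zs xs = rev (map f xs) @ zs"
  by (induction xs arbitrary: zs) auto

lemma filter_foldl: "foldl (\<lambda>s y. if P y then y # s else s) zs xs = rev (filter P xs) @ zs"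
  by (induction xs arbitrary: zs) auto

lemma ptime_sum_list [ptime_intros]:
  fixes f :: "'a::encodable \<Rightarrow> 'b::encodable \<Rightarrow> nat"
  assumes f: "ptime (\<lambda>z. f (fst z) (snd z))" and l: "ptime l"
  shows "ptime (\<lambda>x. sum_list (map (\<lambda>y. f x y) (l x)))"
proof -
  \<comment> \<open>The step of the fold receives parameter, state and element; \<open>f\<close>
    looks at the first and the last only.\<close>
  have f': "ptime (\<lambda>z :: 'a \<times> nat \<times> 'b. f (fst z) (snd (snd z)))"
    using ptime_compose[OF f, of "\<lambda>z :: 'a \<times> nat \<times> 'b. (fst z, snd (snd z))"]
    by (simp add: ptime_intros)
  have "ptime (\<lambda>x. foldl (\<lambda>s y. s + f x y) 0 (l x))"
    by (rule ptime_foldl0[OF _ l ptime_const f])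
      (auto intro!: ptime_intros f' le_SucI sz_add)
  then show ?thesis by (simp add: sum_list_foldl)
qed

lemma ptime_prod_list [ptime_intros]:
  fixes f :: "'a::encodable \<Rightarrow> 'b::encodable \<Rightarrow> nat"
  assumes f: "ptime (\<lambda>z. f (fst z) (snd z))" and l: "ptime l"
  shows "ptime (\<lambda>x. prod_list (map (\<lambda>y. f x y) (l x)))"
proof -
  have f': "ptime (\<lambda>z :: 'a \<times> nat \<times> 'b. f (fst z) (snd (snd z)))"
    using ptime_compose[OF f, of "\<lambda>z :: 'a \<times> nat \<times> 'b. (fst z, snd (snd z))"]
    by (simp add: ptime_intros)
  have "ptime (\<lambda>x. foldl (\<lambda>s y. s * f x y) 1 (l x))"
    by (rule ptime_foldl0[OF _ l ptime_const f])
      (auto intro!: ptime_intros f' le_SucI sz_mult)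
  then show ?thesis by (simp add: prod_list_foldl)
qed

lemma ptime_foldl_max [ptime_intros]:
  assumes l: "ptime l"
  shows "ptime (\<lambda>x. foldl max (0 :: nat) (l x))"
  by (rule ptime_foldl0[OF _ l ptime_const, of _ "\<lambda>x y. y"])
    (auto intro!: ptime_intros le_SucI sz_max)

lemma ptime_rev [ptime_intros]:
  fixes l :: "'a::encodable \<Rightarrow> 'b::encodable list"
  assumes l: "ptime l"
  shows "ptime (\<lambda>x. rev (l x))"
proof -
  have "ptime (\<lambda>x. foldl (\<lambda>s y. y # s) [] (l x))"
    by (rule ptime_foldl0[OF _ l ptime_Nil, of _ "\<lambda>x y. y"]) (auto intro!: ptime_intros)
  then show ?thesis by (simp add: append_foldl)
qed

lemma ptime_append [ptime_intros]:
  fixes l :: "'a::encodable \<Rightarrow> 'b::encodable list"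
  assumes l: "ptime l" and l': "ptime l'"
  shows "ptime (\<lambda>x. l x @ l' x)"
proof -
  have "ptime (\<lambda>x. foldl (\<lambda>s y. y # s) (l' x) (rev (l x)))"
    by (rule ptime_foldl0[OF _ ptime_rev[OF l] l', of _ "\<lambda>x y. y"]) (auto intro!: ptime_intros)
  then show ?thesis by (simp add: append_foldl)
qed

lemma ptime_map [ptime_intros]:
  fixes f :: "'a::encodable \<Rightarrow> 'b::encodable \<Rightarrow> 'c::encodable"
  assumes f: "ptime (\<lambda>z. f (fst z) (snd z))" and l: "ptime l"
  shows "ptime (\<lambda>x. map (\<lambda>y. f x y) (l x))"
proof -
  have f': "ptime (\<lambda>z :: 'a \<times> 'c list \<times> 'b. f (fst z) (snd (snd z)))"
    using ptime_compose[OF f, of "\<lambda>z :: 'a \<times> 'c list \<times> 'b. (fst z, snd (snd z))"]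
    by (simp add: ptime_intros)
  have "ptime (\<lambda>x. rev (foldl (\<lambda>s y. f x y # s) [] (l x)))"
    by (rule ptime_rev, rule ptime_foldl0[OF _ l ptime_Nil f]) (auto intro!: ptime_intros f')
  then show ?thesis by (simp add: map_foldl)
qed

lemma ptime_filter [ptime_intros]:
  fixes P :: "'a::encodable \<Rightarrow> 'b::encodable \<Rightarrow> bool"
  assumes P: "ptime (\<lambda>z. P (fst z) (snd z))" and l: "ptime l"
  shows "ptime (\<lambda>x. filter (\<lambda>y. P x y) (l x))"
proof -
  have P': "ptime (\<lambda>z :: 'a \<times> 'b list \<times> 'b. P (fst z) (snd (snd z)))"
    using ptime_compose[OF P, of "\<lambda>z :: 'a \<times> 'b list \<times> 'b. (fst z, snd (snd z))"]
    by (simp add: ptime_intros)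
  have "ptime (\<lambda>x. rev (foldl (\<lambda>s y. if P x y then y # s else s) [] (l x)))"
    by (rule ptime_rev, rule ptime_foldl0[OF _ l ptime_Nil, of _ "\<lambda>x y. y"])
      (auto intro!: ptime_intros P')
  then show ?thesis by (simp add: filter_foldl)
qed

lemma ptime_length [ptime_intros]:
  assumes "ptime l" shows "ptime (\<lambda>x. length (l x))"
proof -
  have "ptime (\<lambda>x. sum_list (map (\<lambda>y. 1 :: nat) (l x)))" using assms by (intro ptime_intros)
  then show ?thesis by (simp add: sum_list_triv)
qed

section \<open>The greedy cover\<close>

type_synonym arc = "nat \<times> nat \<times> nat"

abbreviation tail :: "arc \<Rightarrow> nat" where "tail \<equiv> fst"
abbreviation head :: "arc \<Rightarrow> nat" where "head e \<equiv> fst (snd e)"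
abbreviation len :: "arc \<Rightarrow> nat" where "len e \<equiv> snd (snd e)"

definition outdeg :: "arc list \<Rightarrow> nat \<Rightarrow> nat" where
  "outdeg T a = length (filter (\<lambda>e. tail e = a) T)"

definition residual :: "(nat \<Rightarrow> nat) \<Rightarrow> arc list \<Rightarrow> nat \<Rightarrow> nat" where
  "residual r T a = r a - outdeg T a"

text \<open>The candidate has centre \<open>head s\<close> and power \<open>len s\<close>, so the
  arcs themselves enumerate the candidates. Whether an arc is affordable is measured by the
  residuals at the start \<open>T0\<close> of the phase, which bounds the power at the tails once
  for the whole phase; whether it is useful, by the current \<open>T\<close>.\<close>

definition star :: "(nat \<Rightarrow> nat) \<Rightarrow> (nat \<Rightarrow> nat) \<Rightarrow> arc list \<Rightarrow> nat \<Rightarrow> arc list \<Rightarrow> arc list \<Rightarrow> arc \<Rightarrow> arc list" where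
  "star r w A d T0 T s = filter (\<lambda>e. head e = head s \<and> len e \<le> len s \<and>
     len e * d \<le> residual r T0 (tail e) * w (tail e) \<and> 0 < residual r T (tail e) \<and> e \<notin> set T) A"

definition gain :: "(nat \<Rightarrow> nat) \<Rightarrow> arc list \<Rightarrow> nat" where
  "gain w S = sum_list (map (\<lambda>e. w (tail e)) S)"

definition pick :: "(nat \<Rightarrow> nat) \<Rightarrow> (nat \<Rightarrow> nat) \<Rightarrow> arc list \<Rightarrow> nat \<Rightarrow> arc list \<Rightarrow> arc list \<Rightarrow> arc \<Rightarrow> arc list" where
  "pick r w A d T0 T s =
     (if len s * d \<le> gain w (star r w A d T0 T s) then star r w A d T0 T s @ T else T)"

text \<open>A single pass over \<open>A\<close> exhausts all stars, because stars only shrink while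
  the set of picked arcs grows.\<close>

definition phase :: "(nat \<Rightarrow> nat) \<Rightarrow> (nat \<Rightarrow> nat) \<Rightarrow> arc list \<Rightarrow> nat \<Rightarrow> arc list \<Rightarrow> arc list" where
  "phase r w A d T = foldl (pick r w A d T) T A"

definition phase_step :: "(nat \<Rightarrow> nat) \<Rightarrow> (nat \<Rightarrow> nat) \<Rightarrow> arc list \<Rightarrow> nat \<times> arc list \<Rightarrow> nat \<times> arc list" where
  "phase_step r w A st = (if fst st = 0 then st else (fst st div 2, phase r w A (fst st) (snd st)))"

text \<open>
  Folding over \<open>A\<close> only limits the number of phases: feasibility forces \<open>k \<le> length A\<close>, so \<open>length A\<close>
  halvings reach \<open>0\<close>.
\<close>

definition greedy_cover :: "(nat \<Rightarrow> nat) \<Rightarrow> (nat \<Rightarrow> nat) \<Rightarrow> arc list \<Rightarrow> nat \<Rightarrow> arc list" where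
  "greedy_cover r w A k = snd (foldl (\<lambda>st e. phase_step r w A st) (k, []) A)"

section \<open>Comparison of the greedy cover with a feasible solution\<close>

lemma length_filter_card: "distinct xs \<Longrightarrow> length (filter P xs) = card {x \<in> set xs. P x}"
  using distinct_card[of "filter P xs"] by simp

text \<open>\<open>P\<close> is the solution to compare with and \<open>\<pi>\<close> its node
  powers; the algorithm knows neither. By \<open>P_tight\<close> the power of \<open>P\<close> at a
  head is the length of some arc into it, so the star of \<open>P\<close> there is dominated by one
  of the candidates. \<open>w_le\<close> makes \<open>w\<close> a lower bound on the power, and
  \<open>w_cover\<close> lets the last phase finish.\<close>

locale arc_cover =
  fixes V :: "nat set" and r w :: "nat \<Rightarrow> nat" and A :: "arc list"
    and P :: "arc set" and \<pi> :: "nat \<Rightarrow> nat"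
  assumes finV: "finite V" and distA: "distinct A"
    and A_V: "e \<in> set A \<Longrightarrow> tail e \<in> V \<and> head e \<in> V"
    and A_inj: "e \<in> set A \<Longrightarrow> e' \<in> set A \<Longrightarrow> tail e = tail e' \<Longrightarrow> head e = head e' \<Longrightarrow> e = e'"
    and P_A: "P \<subseteq> set A"
    and P_le: "e \<in> P \<Longrightarrow> len e \<le> \<pi> (tail e) \<and> len e \<le> \<pi> (head e)"
    and P_deg: "v \<in> V \<Longrightarrow> r v \<le> card {e \<in> P. tail e = v}"
    and P_tight: "e \<in> P \<Longrightarrow> \<exists>s\<in>set A. head s = head e \<and> len s = \<pi> (head e)"
    and w_le: "v \<in> V \<Longrightarrow> w v \<le> \<pi> v"
    and w_cover: "v \<in> V \<Longrightarrow> r v \<le> card {e \<in> set A. tail e = v \<and> len e \<le> w v}"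
begin

definition W :: "arc list \<Rightarrow> nat" where
  "W T = (\<Sum>a\<in>V. residual r T a * w a)"

lemma outdeg_card: "distinct T \<Longrightarrow> outdeg T a = card {e \<in> set T. tail e = a}"
  by (simp add: outdeg_def length_filter_card)

lemma outdeg_mono: "distinct T \<Longrightarrow> distinct T' \<Longrightarrow> set T \<subseteq> set T' \<Longrightarrow> outdeg T a \<le> outdeg T' a"
  by (auto simp: outdeg_card intro: card_mono)

lemma residual_mono:
  "distinct T \<Longrightarrow> distinct T' \<Longrightarrow> set T \<subseteq> set T' \<Longrightarrow> residual r T' a \<le> residual r T a"
  unfolding residual_def by (intro diff_le_mono2 outdeg_mono)

lemma star_set: "e \<in> set (star r w A d T0 T s) \<longleftrightarrow> e \<in> set A \<and> head e = head s \<and> len e \<le> len s \<and>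
     len e * d \<le> residual r T0 (tail e) * w (tail e) \<and> 0 < residual r T (tail e) \<and> e \<notin> set T"
  by (simp add: star_def)

lemma distinct_star: "distinct (star r w A d T0 T s)"
  by (simp add: star_def distA)

lemma gain_sum: "distinct S \<Longrightarrow> gain w S = (\<Sum>e\<in>set S. w (tail e))"
  by (simp add: gain_def sum_list_distinct_conv_sum_set)

lemma star_mono:
  assumes "distinct T" "distinct T'" "set T \<subseteq> set T'"
  shows "set (star r w A d T0 T' s) \<subseteq> set (star r w A d T0 T s)"
proof
  fix e assume "e \<in> set (star r w A d T0 T' s)"
  then show "e \<in> set (star r w A d T0 T s)"
    using assms(3) residual_mono[OF assms, of "tail e"] by (auto simp: star_set)
qed

lemma gain_star_mono:
  assumes "distinct T" "distinct T'" "set T \<subseteq> set T'"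
  shows "gain w (star r w A d T0 T' s) \<le> gain w (star r w A d T0 T s)"
  using star_mono[OF assms] by (simp add: gain_sum distinct_star sum_mono2)

text \<open>The arcs of a star share their head, so by \<open>A_inj\<close> their tails differ. Each
  tail has a positive residual, so its residual drops by exactly one and the subtraction in
  \<open>residual\<close> is not truncated there.\<close>

lemma W_star:
  fixes T T0 d s
  defines "S \<equiv> star r w A d T0 T s"
  shows "W (S @ T) + gain w S = W T"
proof -
  have inj: "inj_on tail (set S)"
    unfolding S_def by (rule inj_onI) (use A_inj in \<open>auto simp: star_set\<close>)
  have dS: "outdeg S a = (if a \<in> tail ` set S then 1 else 0)" for a
  proof (cases "a \<in> tail ` set S")
    case True
    then obtain e where "e \<in> set S" "tail e = a" by blast
    then have "{e \<in> set S. tail e = a} = {e}" using inj by (auto dest: inj_onD)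
    then show ?thesis using True by (simp add: outdeg_card S_def distinct_star)
  next
    case False
    then have "{e \<in> set S. tail e = a} = {}" by force
    then show ?thesis using False by (simp only: outdeg_card S_def distinct_star) simp
  qed
  have "gain w S = (\<Sum>a\<in>tail ` set S. w a)"
    using inj by (simp add: gain_sum S_def distinct_star sum.reindex)
  also have "\<dots> = (\<Sum>a\<in>V. if a \<in> tail ` set S then w a else 0)"
    using A_V by (subst sum.inter_restrict[OF finV, symmetric])
      (auto simp: S_def star_set intro!: sum.cong)
  finally have "W (S @ T) + gain w S =
      (\<Sum>a\<in>V. residual r (S @ T) a * w a + (if a \<in> tail ` set S then w a else 0))"
    by (simp add: W_def sum.distrib)
  also have "\<dots> = W T"
    unfolding W_def
  proof (rule sum.cong[OF refl])
    fix a
    have "outdeg (S @ T) a = outdeg S a + outdeg T a" by (simp add: outdeg_def)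
    moreover have "0 < residual r T a" if "a \<in> tail ` set S"
      using that by (auto simp: S_def star_set)
    ultimately have "residual r T a = residual r (S @ T) a + (if a \<in> tail ` set S then 1 else 0)"
      by (cases "a \<in> tail ` set S") (simp_all add: dS residual_def)
    then show "residual r (S @ T) a * w a + (if a \<in> tail ` set S then w a else 0) = residual r T a * w a"
      by (cases "a \<in> tail ` set S") simp_all
  qed
  finally show ?thesis .
qed

text \<open>\<open>\<beta>\<close> is the power spent at the heads of the stars picked since \<open>T0\<close>.\<close>

definition phase_inv :: "nat \<Rightarrow> arc list \<Rightarrow> arc list \<Rightarrow> (nat \<Rightarrow> nat) \<Rightarrow> bool" where
  "phase_inv d T0 T \<beta> \<longleftrightarrow> set T \<subseteq> set A \<and> distinct T \<and> set T0 \<subseteq> set T \<and>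
     (\<forall>e\<in>set T - set T0. len e * d \<le> residual r T0 (tail e) * w (tail e) \<and> len e \<le> \<beta> (head e)) \<and>
     d * sum \<beta> V + W T \<le> W T0"

lemma pick_inv:
  assumes inv: "phase_inv d T0 T \<beta>" and s: "s \<in> set A"
  obtains \<beta>' where "phase_inv d T0 (pick r w A d T0 T s) \<beta>'"
proof (cases "len s * d \<le> gain w (star r w A d T0 T s)")
  case False
  with inv that show ?thesis by (simp add: pick_def)
next
  case True
  let ?S = "star r w A d T0 T s"
  \<comment> \<open>The picked star raises the budget of its centre by \<open>len s\<close>; its
    gain of at least \<open>len s * d\<close> pays for this.\<close>
  let ?b = "\<lambda>v. \<beta> v + (if v = head s then len s else 0)"
  have "sum ?b V = sum \<beta> V + len s"
    using s A_V finV by (simp add: sum.distrib)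
  then have "d * sum ?b V + W (?S @ T) \<le> W T0"
    using True W_star[of d T0 T s] inv by (simp add: phase_inv_def algebra_simps)
  moreover have "len e * d \<le> residual r T0 (tail e) * w (tail e) \<and> len e \<le> ?b (head e)"
    if e: "e \<in> set (?S @ T) - set T0" for e
  proof (cases "e \<in> set ?S")
    case True
    then show ?thesis by (simp add: star_set)
  next
    case False
    with e inv have "len e * d \<le> residual r T0 (tail e) * w (tail e)" "len e \<le> \<beta> (head e)"
      by (auto simp: phase_inv_def)
    then show ?thesis by simp
  qed
  ultimately have "phase_inv d T0 (?S @ T) ?b"
    using inv unfolding phase_inv_def by (auto simp: star_set distinct_star)
  with that True show ?thesis by (simp add: pick_def)
qed

text \<open>A rejected star stays too sparse, since its gain can only fall. After an accepted one,
  any later star at \<open>s\<close> is contained in the arcs already taken, yet avoids them, so it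
  is empty.\<close>

lemma pick_done:
  assumes inv: "phase_inv d T0 T \<beta>"
    and T': "distinct T'" "set (pick r w A d T0 T s) \<subseteq> set T'" "set T \<subseteq> set T'"
  shows "star r w A d T0 T' s = [] \<or> gain w (star r w A d T0 T' s) < len s * d"
proof (cases "len s * d \<le> gain w (star r w A d T0 T s)")
  case False
  have "distinct T" using inv by (simp add: phase_inv_def)
  from gain_star_mono[OF this T'(1,3), of d T0 s] False show ?thesis by simp
next
  case True
  have "distinct T" using inv by (simp add: phase_inv_def)
  from star_mono[OF this T'(1,3), of d T0 s]
  have "set (star r w A d T0 T' s) \<subseteq> set T'" using True T'(2) by (auto simp: pick_def)
  moreover have "set (star r w A d T0 T' s) \<inter> set T' = {}" by (auto simp: star_set)
  ultimately show ?thesis by (metis inf.absorb1 set_empty)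
qed

text \<open>Later picks cannot revive a candidate (\<open>pick_done\<close>), so one pass settles
  all elements of \<open>B\<close>.\<close>

lemma picks_inv:
  assumes "phase_inv d T0 T \<beta>" "set B \<subseteq> set A"
  shows "\<exists>\<beta>'. phase_inv d T0 (foldl (pick r w A d T0) T B) \<beta>' \<and>
    set T \<subseteq> set (foldl (pick r w A d T0) T B) \<and>
    (\<forall>s\<in>set B. star r w A d T0 (foldl (pick r w A d T0) T B) s = [] \<or>
       gain w (star r w A d T0 (foldl (pick r w A d T0) T B) s) < len s * d)"
  using assms
proof (induction B arbitrary: T \<beta>)
  case (Cons s B)
  let ?T = "pick r w A d T0 T s" and ?T' = "foldl (pick r w A d T0) T (s # B)"
  obtain \<beta>' where "phase_inv d T0 ?T \<beta>'"
    using pick_inv[OF Cons.prems(1), of s] Cons.prems(2) by auto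
  with Cons.IH[OF this] Cons.prems(2) obtain \<beta>'' where IH: "phase_inv d T0 ?T' \<beta>''" "set ?T \<subseteq> set ?T'"
    "\<forall>s\<in>set B. star r w A d T0 ?T' s = [] \<or> gain w (star r w A d T0 ?T' s) < len s * d"
    by auto
  have "set T \<subseteq> set ?T" by (auto simp: pick_def)
  with IH(2) have sub: "set T \<subseteq> set ?T'" by blast
  have "distinct ?T'" using IH(1) by (simp add: phase_inv_def)
  from pick_done[OF Cons.prems(1) this IH(2) sub] IH sub show ?case by auto
qed auto

lemma phase_exhausted:
  assumes inv: "phase_inv d T0 T \<beta>" and T0: "distinct T0" "set T0 \<subseteq> set A" and d: "0 < d"
    and stars: "\<And>s. s \<in> set A \<Longrightarrow> star r w A d T0 T s = [] \<or> gain w (star r w A d T0 T s) < len s * d"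
  shows "W T \<le> 2 * d * sum \<pi> V"
proof -
  have T: "distinct T" "set T0 \<subseteq> set T" using inv by (auto simp: phase_inv_def)
  \<comment> \<open>The arcs of \<open>P\<close> that are not taken, but affordable and
    useful.\<close>
  define U where "U = {e \<in> P. e \<notin> set T \<and> len e * d \<le> residual r T0 (tail e) * w (tail e) \<and>
    0 < residual r T (tail e)}"
  have finP: "finite P" using P_A finite_subset by blast
  then have finU: "finite U" by (simp add: U_def)
  have head_le: "(\<Sum>e\<in>{e \<in> U. head e = b}. w (tail e)) \<le> d * \<pi> b" for b
  proof (cases "{e \<in> U. head e = b} = {}")
    case False
    then obtain e where e: "e \<in> P" "head e = b" by (auto simp: U_def)
    \<comment> \<open>All arcs of \<open>U\<close> into \<open>b\<close> have length at most
      \<open>\<pi> b\<close>, so the star of \<open>s\<close> contains them, and that star is too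
      sparse to be picked.\<close>
    from P_tight[OF e(1)] e obtain s where s: "s \<in> set A" "head s = b" "len s = \<pi> b" by auto
    have sub: "{e \<in> U. head e = b} \<subseteq> set (star r w A d T0 T s)"
      using s P_le P_A by (auto simp: U_def star_set)
    then have "(\<Sum>e\<in>{e \<in> U. head e = b}. w (tail e)) \<le> gain w (star r w A d T0 T s)"
      by (auto simp: gain_sum distinct_star intro!: sum_mono2)
    also have "\<dots> \<le> d * \<pi> b"
      using stars[OF s(1)] False sub s(3) by (auto simp: mult.commute)
    finally show ?thesis .
  next
    case True
    show ?thesis unfolding True by simp
  qed
  \<comment> \<open>Double counting: \<open>U\<close> is needed grouped by tails, while the bound is
    available for groups by heads.\<close>
  have "(\<Sum>a\<in>V. \<Sum>e\<in>{e \<in> U. tail e = a}. w a) = (\<Sum>e\<in>U. w (tail e))"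
    using A_V P_A finU finV
    by (subst sum.group[of U V tail "\<lambda>e. w (tail e)", symmetric]) (auto simp: U_def intro!: sum.cong)
  also have "\<dots> = (\<Sum>b\<in>V. \<Sum>e\<in>{e \<in> U. head e = b}. w (tail e))"
    using A_V P_A finU finV by (subst sum.group) (auto simp: U_def)
  also have "\<dots> \<le> (\<Sum>b\<in>V. d * \<pi> b)" by (intro sum_mono head_le)
  finally have U_le: "(\<Sum>a\<in>V. \<Sum>e\<in>{e \<in> U. tail e = a}. w a) \<le> (\<Sum>b\<in>V. d * \<pi> b)" .
  have "residual r T a * w a \<le> d * \<pi> a + (\<Sum>e\<in>{e \<in> U. tail e = a}. w a)" if a: "a \<in> V" for a
  proof (cases "\<forall>e\<in>P. tail e = a \<longrightarrow> len e * d \<le> residual r T0 a * w a")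
    case True
    have "residual r T a \<le> card {e \<in> U. tail e = a}" if pos: "0 < residual r T a"
    proof -
      \<comment> \<open>No arc of \<open>P\<close> from \<open>a\<close> is too expensive here, so
        those outside \<open>T\<close> all lie in \<open>U\<close>, and they number at least
        \<open>residual r T a\<close>.\<close>
      have "{e \<in> P. tail e = a} \<subseteq> {e \<in> U. tail e = a} \<union> {e \<in> set T. tail e = a}"
        using True pos by (auto simp: U_def)
      then have "card {e \<in> P. tail e = a} \<le> card ({e \<in> U. tail e = a} \<union> {e \<in> set T. tail e = a})"
        using finU by (intro card_mono) auto
      also have "\<dots> \<le> card {e \<in> U. tail e = a} + outdeg T a"
        by (simp add: outdeg_card T card_Un_le)
      finally show ?thesis using P_deg[OF a] by (simp add: residual_def)
    qed
    then have "residual r T a * w a \<le> card {e \<in> U. tail e = a} * w a"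
      by (cases "0 < residual r T a") (auto intro: mult_le_mono1)
    moreover have "(\<Sum>e\<in>{e \<in> U. tail e = a}. w a) = card {e \<in> U. tail e = a} * w a" by simp
    ultimately show ?thesis by linarith
  next
    case False
    \<comment> \<open>A single arc of \<open>P\<close> that is too expensive already bounds the
      whole contribution of \<open>a\<close> by \<open>d * \<pi> a\<close>.\<close>
    then obtain e where e: "e \<in> P" "tail e = a" "residual r T0 a * w a < len e * d" by auto
    have "residual r T a * w a \<le> residual r T0 a * w a"
      by (intro mult_le_mono1 residual_mono T T0)
    also have "\<dots> \<le> len e * d" using e by simp
    also have "\<dots> \<le> d * \<pi> a" using P_le[OF e(1)] e(2) by (simp add: mult.commute)
    finally show ?thesis by simp
  qed
  then have "W T \<le> (\<Sum>a\<in>V. d * \<pi> a + (\<Sum>e\<in>{e \<in> U. tail e = a}. w a))"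
    unfolding W_def by (rule sum_mono)
  also have "\<dots> \<le> 2 * d * sum \<pi> V"
    using U_le by (simp add: sum.distrib sum_distrib_left[symmetric] del: sum_constant)
  finally show ?thesis .
qed

text \<open>An unserved \<open>a\<close> has an arc \<open>e\<close> outside \<open>T\<close> with
  \<open>len e \<le> w a\<close>. For \<open>d = 1\<close> it is affordable, and its own star gains
  at least \<open>w a\<close>, hence at least \<open>len e\<close>, which contradicts
  exhaustion.\<close>

lemma final_phase:
  assumes inv: "phase_inv 1 T0 T \<beta>" and T0: "distinct T0" "set T0 \<subseteq> set A" and a: "a \<in> V"
    and stars: "\<And>s. s \<in> set A \<Longrightarrow> star r w A 1 T0 T s = [] \<or> gain w (star r w A 1 T0 T s) < len s * 1"
  shows "residual r T a = 0"
proof (rule ccontr)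
  have T: "distinct T" "set T0 \<subseteq> set T" using inv by (auto simp: phase_inv_def)
  assume "residual r T a \<noteq> 0"
  then have pos: "0 < residual r T a" by simp
  have "\<not> {e \<in> set A. tail e = a \<and> len e \<le> w a} \<subseteq> {e \<in> set T. tail e = a}"
  proof
    assume "{e \<in> set A. tail e = a \<and> len e \<le> w a} \<subseteq> {e \<in> set T. tail e = a}"
    then have "card {e \<in> set A. tail e = a \<and> len e \<le> w a} \<le> outdeg T a"
      unfolding outdeg_card[OF T(1)] by (intro card_mono) auto
    then show False using w_cover[OF a] pos by (simp add: residual_def)
  qed
  then obtain e where e: "e \<in> set A" "tail e = a" "len e \<le> w a" "e \<notin> set T" by auto
  have "1 \<le> residual r T0 a" using pos residual_mono[OF T0(1) T, of a] by simp
  then have "w a \<le> residual r T0 a * w a" by simp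
  with e(3) have "len e \<le> residual r T0 a * w a" by (rule le_trans)
  with e pos have mem: "e \<in> set (star r w A 1 T0 T e)" by (auto simp: star_set)
  then have "w a \<le> gain w (star r w A 1 T0 T e)"
    using e(2) by (auto simp: gain_sum distinct_star intro: member_le_sum)
  with stars[OF e(1)] mem e(3) show False by auto
qed

section \<open>Combining the phases\<close>

definition powered :: "arc list \<Rightarrow> (nat \<Rightarrow> nat) \<Rightarrow> bool" where
  "powered T q \<longleftrightarrow> (\<forall>e\<in>set T. len e \<le> q (tail e) \<and> len e \<le> q (head e))"

text \<open>The node powers are tracked by upper bounds \<open>q\<close> instead of maxima, so that
  the expenses of successive phases simply add up.\<close>

lemma phase_correct:
  assumes T: "distinct T" "set T \<subseteq> set A" "powered T q" and d: "0 < d"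
  defines "T' \<equiv> phase r w A d T"
  obtains q' where "distinct T'" "set T' \<subseteq> set A" "powered T' q'"
    "d * sum q' V \<le> d * sum q V + 2 * W T" "W T' \<le> 2 * d * sum \<pi> V"
    "d = 1 \<longrightarrow> (\<forall>a\<in>V. residual r T' a = 0)"
proof -
  have "phase_inv d T T (\<lambda>v. 0)" using T by (simp add: phase_inv_def)
  from picks_inv[OF this, of A] obtain \<beta> where inv: "phase_inv d T T' \<beta>"
    and stars: "\<And>s. s \<in> set A \<Longrightarrow> star r w A d T T' s = [] \<or> gain w (star r w A d T T' s) < len s * d"
    unfolding T'_def phase_def by auto
  \<comment> \<open>The second summand is the longest affordable length for a tail, where rounding
    down loses nothing as lengths are integers; \<open>\<beta>\<close> covers the heads. Each of
    them sums to at most \<open>W T / d\<close>.\<close>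
  let ?q = "\<lambda>v. q v + (residual r T v * w v div d + \<beta> v)"
  have "distinct T'" "set T' \<subseteq> set A" using inv by (auto simp: phase_inv_def)
  moreover have "powered T' ?q"
    unfolding powered_def
  proof
    fix e assume e: "e \<in> set T'"
    show "len e \<le> ?q (tail e) \<and> len e \<le> ?q (head e)"
    proof (cases "e \<in> set T")
      case True
      then show ?thesis using T(3) by (auto simp: powered_def intro: trans_le_add1)
    next
      case False
      with e inv have "len e * d \<le> residual r T (tail e) * w (tail e)" "len e \<le> \<beta> (head e)"
        by (auto simp: phase_inv_def)
      moreover from this(1) have "len e \<le> residual r T (tail e) * w (tail e) div d"
        using d by (simp add: less_eq_div_iff_mult_less_eq)
      ultimately show ?thesis by simp
    qed
  qed
  moreover have "d * sum ?q V \<le> d * sum q V + 2 * W T"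
  proof -
    have "d * (\<Sum>v\<in>V. residual r T v * w v div d) \<le> W T"
      unfolding W_def sum_distrib_left by (intro sum_mono) simp
    moreover have "d * sum \<beta> V \<le> W T" using inv by (auto simp: phase_inv_def)
    ultimately show ?thesis by (simp add: sum.distrib distrib_left)
  qed
  moreover have "W T' \<le> 2 * d * sum \<pi> V" by (rule phase_exhausted[OF inv T(1,2) d stars])
  moreover have "\<forall>a\<in>V. residual r T' a = 0" if "d = 1"
    using final_phase[OF inv[unfolded that] T(1,2) _ stars[unfolded that]] by blast
  ultimately show ?thesis using that by blast
qed

text \<open>With \<open>W T \<le> 6 * d * sum \<pi> V\<close> a phase, which costs at most
  \<open>2 * W T / d\<close>, costs at most \<open>12 * sum \<pi> V\<close>;
  \<open>floorlog 2 d\<close> counts the halvings until \<open>d\<close> is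
  \<open>0\<close>.\<close>

lemma phases_correct:
  assumes "distinct T" "set T \<subseteq> set A" "powered T q" "W T \<le> 6 * d * sum \<pi> V"
    and "d = 0 \<Longrightarrow> \<forall>a\<in>V. residual r T a = 0" and "d < 2 ^ length (B :: arc list)"
  shows "\<exists>q'. set (snd (foldl (\<lambda>st e. phase_step r w A st) (d, T) B)) \<subseteq> set A \<and>
    distinct (snd (foldl (\<lambda>st e. phase_step r w A st) (d, T) B)) \<and>
    powered (snd (foldl (\<lambda>st e. phase_step r w A st) (d, T) B)) q' \<and>
    sum q' V \<le> sum q V + 12 * floorlog 2 d * sum \<pi> V \<and>
    (\<forall>a\<in>V. residual r (snd (foldl (\<lambda>st e. phase_step r w A st) (d, T) B)) a = 0)"
  using assms
proof (induction B arbitrary: d T q)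
  case Nil
  then show ?case by auto
next
  case (Cons e B)
  show ?case
  proof (cases "d = 0")
    case True
    have "phase_step r w A (0, T) = (0, T)" by (simp add: phase_step_def)
    with Cons.IH[of T q 0] Cons.prems True show ?thesis by simp
  next
    case False
    then have pos: "0 < d" by simp
    let ?T = "phase r w A d T"
    obtain q' where q': "distinct ?T" "set ?T \<subseteq> set A" "powered ?T q'"
      "d * sum q' V \<le> d * sum q V + 2 * W T" "W ?T \<le> 2 * d * sum \<pi> V"
      "d = 1 \<longrightarrow> (\<forall>a\<in>V. residual r ?T a = 0)"
      by (rule phase_correct[OF Cons.prems(1-3) pos])
    have step: "phase_step r w A (d, T) = (d div 2, ?T)" using False by (simp add: phase_step_def)
    have log: "floorlog 2 d = floorlog 2 (d div 2) + 1"
      using False compute_floorlog[of 2 d] by simp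
    have half: "W ?T \<le> 6 * (d div 2) * sum \<pi> V \<or> d = 1"
    proof (cases "d = 1")
      case False
      \<comment> \<open>The worst case is \<open>d = 3\<close>. This is where the 6 comes from: the
        \<open>2 * d\<close> left by a phase must fit the rounded half of \<open>d\<close>.\<close>
      with \<open>d \<noteq> 0\<close> have "d \<le> 3 * (d div 2)" by presburger
      then have "2 * d * sum \<pi> V \<le> 6 * (d div 2) * sum \<pi> V" by (intro mult_le_mono1) simp
      with q'(5) show ?thesis by (blast intro: le_trans)
    qed simp
    \<comment> \<open>For \<open>d = 1\<close> the right-hand side is \<open>0\<close>, but then all
      residuals vanish as well.\<close>
    have W1: "W ?T \<le> 6 * (d div 2) * sum \<pi> V"
      using half q'(6) by (auto simp: W_def)
    have zero: "d div 2 = 0 \<Longrightarrow> \<forall>a\<in>V. residual r ?T a = 0" using q'(6) False by (simp add: div_eq_0_iff)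
    have len: "d div 2 < 2 ^ length B" using Cons.prems(6) by auto
    obtain q'' where q'': "set (snd (foldl (\<lambda>st e. phase_step r w A st) (d div 2, ?T) B)) \<subseteq> set A"
      "distinct (snd (foldl (\<lambda>st e. phase_step r w A st) (d div 2, ?T) B))"
      "powered (snd (foldl (\<lambda>st e. phase_step r w A st) (d div 2, ?T) B)) q''"
      "sum q'' V \<le> sum q' V + 12 * floorlog 2 (d div 2) * sum \<pi> V"
      "\<forall>a\<in>V. residual r (snd (foldl (\<lambda>st e. phase_step r w A st) (d div 2, ?T) B)) a = 0"
      using Cons.IH[OF q'(1-3) W1 zero len] by blast
    have "d * sum q' V \<le> d * (sum q V + 12 * sum \<pi> V)"
      using q'(4) Cons.prems(4) by (simp add: algebra_simps)
    then have "sum q' V \<le> sum q V + 12 * sum \<pi> V" using False by simp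
    with q''(4) have "sum q'' V \<le> sum q V + 12 * floorlog 2 d * sum \<pi> V"
      by (simp add: log algebra_simps)
    with q'' step show ?thesis by auto
  qed
qed

theorem greedy_cover_correct:
  assumes k: "\<And>v. v \<in> V \<Longrightarrow> r v \<le> k" and len: "k < 2 ^ length A"
  obtains q where "set (greedy_cover r w A k) \<subseteq> set A" "distinct (greedy_cover r w A k)"
    "powered (greedy_cover r w A k) q" "sum q V \<le> 12 * floorlog 2 k * sum \<pi> V"
    "\<And>a. a \<in> V \<Longrightarrow> r a \<le> outdeg (greedy_cover r w A k) a"
proof -
  have "W [] \<le> (\<Sum>a\<in>V. k * \<pi> a)"
    unfolding W_def by (intro sum_mono mult_le_mono w_le) (auto simp: residual_def outdeg_def k)
  then have "W [] \<le> 6 * k * sum \<pi> V" by (simp add: sum_distrib_left[symmetric])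
  moreover have "powered [] (\<lambda>v. 0)" by (simp add: powered_def)
  moreover have "k = 0 \<Longrightarrow> \<forall>a\<in>V. residual r [] a = 0" using k by (simp add: residual_def)
  ultimately show ?thesis
    using phases_correct[of "[]" "\<lambda>v. 0" k A] len that
    unfolding greedy_cover_def by (auto simp: residual_def)
qed

end

section \<open>The algorithm on encoded instances\<close>

text \<open>Table lookup in the form of a sum, to which the closure rules apply; the keys will be
  distinct, and missing keys yield \<open>0\<close>.\<close>

definition demand :: "(nat \<times> nat) list \<Rightarrow> nat \<Rightarrow> nat" where
  "demand R a = sum_list (map snd (filter (\<lambda>p. fst p = a) R))"

text \<open>The cost of the \<open>r\<close>-th cheapest edge at \<open>a\<close>, where \<open>r\<close> is the degree bound of \<open>a\<close>.\<close>

definition weight :: "(nat \<times> nat) list \<Rightarrow> arc list \<Rightarrow> nat \<Rightarrow> nat" where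
  "weight R A a = foldl max 0 (map (\<lambda>e. len e) (filter (\<lambda>e. tail e = a \<and>
     length (filter (\<lambda>e'. tail e' = a \<and> len e' < len e) A) < demand R a) A))"

type_synonym edge_item = "(nat \<times> nat) \<times> (nat \<times> nat)"

text \<open>The product serves as common multiple: no gcd has to be computed, and its bit size stays
  polynomial.\<close>

definition common_den :: "edge_item list \<Rightarrow> nat" where
  "common_den es = prod_list (map (\<lambda>x. snd (snd x)) es)"

definition scaled :: "edge_item list \<Rightarrow> edge_item \<Rightarrow> nat" where
  "scaled es x = fst (snd x) * (common_den es div snd (snd x))"

text \<open>An edge may serve either end, so it appears in both orientations.\<close>

definition arcs_of :: "edge_item list \<Rightarrow> arc list" where
  "arcs_of es = map (\<lambda>x. (fst (fst x), snd (fst x), scaled es x)) es @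
     map (\<lambda>x. (snd (fst x), fst (fst x), scaled es x)) es"

definition solve :: "(nat \<times> nat) list \<times> edge_item list \<Rightarrow> (nat \<times> nat) list" where
  "solve x = map (\<lambda>e. (tail e, head e)) (greedy_cover (demand (fst x))
     (weight (fst x) (arcs_of (snd x))) (arcs_of (snd x)) (foldl max 0 (map snd (fst x))))"

section \<open>Polynomial running time of the algorithm\<close>

lemma ptime_binary:
  assumes "ptime (\<lambda>z. f (fst z) (snd z))" "ptime a" "ptime b"
  shows "ptime (\<lambda>x. f (a x) (b x))"
  using ptime_compose[OF assms(1) ptime_Pair[OF assms(2,3)]] by simp

lemma ptime_ternary:
  assumes "ptime (\<lambda>z. f (fst z) (fst (snd z)) (snd (snd z)))" "ptime a" "ptime b" "ptime c"
  shows "ptime (\<lambda>x. f (a x) (b x) (c x))"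
  using ptime_compose[OF assms(1) ptime_Pair[OF assms(2) ptime_Pair[OF assms(3,4)]]] by simp

lemma ptime_demand [ptime_intros]:
  assumes "ptime R" "ptime a"
  shows "ptime (\<lambda>x. demand (R x) (a x))"
  by (rule ptime_binary[OF _ assms]) (unfold demand_def, intro ptime_intros)

lemma ptime_weight [ptime_intros]:
  assumes "ptime R" "ptime A" "ptime a"
  shows "ptime (\<lambda>x. weight (R x) (A x) (a x))"
  by (rule ptime_ternary[OF _ assms]) (unfold weight_def, intro ptime_intros)

lemma ptime_arc_mem [ptime_intros]:
  fixes e :: "'a::encodable \<Rightarrow> arc"
  assumes "ptime e" "ptime T"
  shows "ptime (\<lambda>x. e x \<in> set (T x))"
proof (rule ptime_binary[OF _ assms])
  \<comment> \<open>Equality of arcs is reduced to equality of numbers, and membership to a filtered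
    list being nonempty, for which closure rules exist.\<close>
  have eq: "(tail e' = tail e \<and> head e' = head e \<and> len e' = len e) = (e' = e)" for e' e :: arc
    by (auto simp: prod_eq_iff)
  have "(\<lambda>z :: arc \<times> arc list. fst z \<in> set (snd z)) = (\<lambda>z. \<not> length (filter (\<lambda>e'.
      tail e' = tail (fst z) \<and> head e' = head (fst z) \<and> len e' = len (fst z)) (snd z)) = 0)"
    unfolding eq by (auto simp: fun_eq_iff filter_empty_conv)
  then show "ptime (\<lambda>z :: arc \<times> arc list. fst z \<in> set (snd z))"
    by (simp only:) (intro ptime_intros)
qed

text \<open>Functions such as \<open>r\<close> and \<open>w\<close> have no encoding; the rule is
  therefore stated for \<open>demand\<close> and \<open>weight\<close>, which are given by the data
  \<open>R\<close> and \<open>A\<close>.\<close>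

lemma ptime_star [ptime_intros]:
  assumes "ptime R" "ptime A" "ptime d" "ptime T0" "ptime T" "ptime s"
  shows "ptime (\<lambda>x. star (demand (R x)) (weight (R x) (A x)) (A x) (d x) (T0 x) (T x) (s x))"
proof -
  let ?f = "\<lambda>z. star (demand (fst z)) (weight (fst z) (fst (snd z))) (fst (snd z)) (fst (snd (snd z)))
    (fst (snd (snd (snd z)))) (fst (snd (snd (snd (snd z))))) (snd (snd (snd (snd (snd z)))))"
  have "ptime ?f"
    unfolding star_def residual_def outdeg_def by (intro ptime_intros)
  from ptime_compose[OF this, of "\<lambda>x. (R x, A x, d x, T0 x, T x, s x)"] assms
  show ?thesis by (simp add: ptime_intros)
qed

lemma ptime_gain [ptime_intros]:
  assumes "ptime R" "ptime A" "ptime S"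
  shows "ptime (\<lambda>x. gain (weight (R x) (A x)) (S x))"
  by (rule ptime_ternary[OF _ assms]) (unfold gain_def, intro ptime_intros)

lemma ptime_pick [ptime_intros]:
  assumes "ptime R" "ptime A" "ptime d" "ptime T0" "ptime T" "ptime s"
  shows "ptime (\<lambda>x. pick (demand (R x)) (weight (R x) (A x)) (A x) (d x) (T0 x) (T x) (s x))"
  unfolding pick_def using assms by (intro ptime_intros)

text \<open>A star is a sublist of \<open>A\<close>, so the state grows by an amount independent of
  it, as \<open>ptime_foldl\<close> requires.\<close>

lemma sz_pick: "sz (pick r w A d T0 T s) \<le> sz T + sz A"
  using sz_append[of "star r w A d T0 T s" T] sz_filter[of _ A]
  by (auto simp: pick_def star_def intro: order_trans)

lemma sz_phase: "sz (phase r w A d T) \<le> sz T + length A * sz A"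
proof -
  have "sz (foldl (pick r w A d T0) T B) \<le> sz T + length B * sz A" for T0 B
  proof (induction B arbitrary: T)
    case (Cons s B)
    from Cons[of "pick r w A d T0 T s"] sz_pick[of r w A d T0 T s] show ?case by simp
  qed simp
  then show ?thesis by (simp add: phase_def)
qed

lemma ptime_phase [ptime_intros]:
  assumes "ptime R" "ptime A" "ptime d" "ptime T"
  shows "ptime (\<lambda>x. phase (demand (R x)) (weight (R x) (A x)) (A x) (d x) (T x))"
proof -
  let ?f = "\<lambda>z. phase (demand (fst z)) (weight (fst z) (fst (snd z))) (fst (snd z)) (fst (snd (snd z)))
    (snd (snd (snd z)))"
  have "ptime ?f"
    unfolding phase_def
  proof (rule ptime_foldl[where g = "[:0, 1:]"])
    fix z :: "(nat \<times> nat) list \<times> arc list \<times> nat \<times> arc list" and T :: "arc list" and s :: arc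
    show "sz (pick (demand (fst z)) (weight (fst z) (fst (snd z))) (fst (snd z)) (fst (snd (snd z)))
      (snd (snd (snd z))) T s) \<le> sz T + poly [:0, 1:] (sz z + sz s)"
      by (rule order_trans[OF sz_pick]) (cases z, auto)
  qed (intro ptime_intros)+
  from ptime_compose[OF this, of "\<lambda>x. (R x, A x, d x, T x)"] assms
  show ?thesis by (simp add: ptime_intros)
qed

lemma ptime_phase_step [ptime_intros]:
  assumes "ptime R" "ptime A" "ptime st"
  shows "ptime (\<lambda>x. phase_step (demand (R x)) (weight (R x) (A x)) (A x) (st x))"
  unfolding phase_step_def using assms by (intro ptime_intros)

lemma sz_phase_step: "sz (phase_step r w A st) \<le> sz st + sz A * sz A"
proof (cases "fst st = 0")
  case False
  obtain d T where st: "st = (d, T)" by fastforce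
  have "sz (phase r w A d T) \<le> sz T + sz A * sz A"
    by (rule order_trans[OF sz_phase]) (use length_le_sz[of A] in simp)
  moreover have "sz (d div 2) \<le> sz d" by (rule sz_nat_mono) simp
  ultimately show ?thesis using False by (simp add: phase_step_def st)
qed (simp add: phase_step_def)

lemma ptime_greedy_cover [ptime_intros]:
  assumes "ptime R" "ptime A" "ptime k"
  shows "ptime (\<lambda>x. greedy_cover (demand (R x)) (weight (R x) (A x)) (A x) (k x))"
proof -
  let ?f = "\<lambda>z. foldl (\<lambda>st e. phase_step (demand (fst z)) (weight (fst z) (fst (snd z))) (fst (snd z)) st)
    (snd (snd z), []) (fst (snd z))"
  have "ptime ?f"
  proof (rule ptime_foldl[where g = "[:0, 0, 1:]"])
    fix z :: "(nat \<times> nat) list \<times> arc list \<times> nat" and st :: "nat \<times> arc list" and e :: arc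
    have "sz (fst (snd z)) \<le> sz z + sz e" by (cases z) auto
    then have "sz (fst (snd z)) * sz (fst (snd z)) \<le> (sz z + sz e) * (sz z + sz e)"
      by (intro mult_le_mono)
    with sz_phase_step[of "demand (fst z)" "weight (fst z) (fst (snd z))" "fst (snd z)" st]
    show "sz (phase_step (demand (fst z)) (weight (fst z) (fst (snd z))) (fst (snd z)) st)
      \<le> sz st + poly [:0, 0, 1:] (sz z + sz e)"
      by simp
  qed (intro ptime_intros)+
  from ptime_snd[OF ptime_compose[OF this, of "\<lambda>x. (R x, A x, k x)"]] assms
  show ?thesis by (simp add: greedy_cover_def ptime_intros)
qed

lemma ptime_arcs_of [ptime_intros]:
  assumes "ptime es" shows "ptime (\<lambda>x. arcs_of (es x))"
proof -
  have "ptime arcs_of"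
    unfolding arcs_of_def[abs_def] scaled_def common_den_def by (intro ptime_intros)
  then show ?thesis using assms by (rule ptime_compose)
qed

lemma ptime_solve: "ptime solve"
  unfolding solve_def[abs_def] by (intro ptime_intros)

text \<open>The expression \<open>e\<close> becomes function 0, the entry point of the program; its
  auxiliary code is therefore compiled for offset 1.\<close>

lemma ptime_program:
  assumes "ptime f"
  obtains A p where "\<And>x. \<exists>t\<le>poly p (sz x). runs_to A (enc x) (enc (f x)) t"
proof -
  obtain p where "\<And>n. \<exists>P e. implements n P e f p" using ptimeE[OF assms] by blast
  then obtain P e where P: "implements 1 P e f p" by blast
  have l: "length [e] = 1" by simp
  have "\<exists>t\<le>poly ([:0, 1:] + smult 2 p) (sz x). runs_to (e # P) (enc x) (enc (f x)) t" for x
  proof -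
    obtain t where t: "t \<le> poly p (sz x)" "eval ([e] @ P @ []) (enc x # []) e (enc (f x)) t"
      by (rule implementsD[OF P l])
    have "evals (e # P) [enc x] [Var 0] [enc x] (sz x + 0)"
      using eval_evals.Var[of 0 "[enc x]" "e # P"] by (intro eval_evals.intros) (simp add: sz_def)
    from eval_evals.Call[OF _ this, of 0 "enc (f x)" t] t(2)
    have "runs_to (e # P) (enc x) (enc (f x)) (sz x + 0 + t + vsize (enc (f x)))"
      by (simp add: runs_to_def)
    moreover have "sz x + 0 + t + vsize (enc (f x)) \<le> poly ([:0, 1:] + smult 2 p) (sz x)"
      using t(1) eval_size[OF t(2)] by simp
    ultimately show ?thesis by blast
  qed
  then show ?thesis using that by blast
qed

section \<open>Properties of demands, denominators and weights\<close>

lemma foldl_max: "foldl max a xs = Max (insert a (set xs))"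
  for a :: "'a::linorder"
proof (induction xs arbitrary: a)
  case (Cons y xs)
  then show ?case by (cases "xs = []") (simp_all add: max.assoc)
qed simp

lemma demand_map:
  "distinct vs \<Longrightarrow> demand (map (\<lambda>v. (v, r v)) vs) a = (if a \<in> set vs then r a else 0)"
  by (induction vs) (auto simp: demand_def)

lemma common_den_dvd: "x \<in> set es \<Longrightarrow> snd (snd x) dvd common_den es"
  by (induction es) (auto simp: common_den_def)

lemma common_den_pos: "(\<And>x. x \<in> set es \<Longrightarrow> 0 < snd (snd x)) \<Longrightarrow> 0 < common_den es"
  by (induction es) (auto simp: common_den_def)

text \<open>An arc counted by \<open>weight\<close> has fewer than \<open>demand R a\<close>
  strictly shorter competitors; if it were longer than \<open>m\<close>, all arcs of length at most
  \<open>m\<close> would be such competitors. With \<open>m\<close> the power of \<open>a\<close> in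
  a cover, this is the lower bound on the optimum.\<close>

lemma weight_le:
  assumes "distinct A" "demand R a \<le> card {e \<in> set A. tail e = a \<and> len e \<le> m}"
  shows "weight R A a \<le> m"
proof -
  have "len e \<le> m" if e: "e \<in> set A" "tail e = a"
    "length (filter (\<lambda>e'. tail e' = a \<and> len e' < len e) A) < demand R a" for e
  proof (rule ccontr)
    assume "\<not> len e \<le> m"
    then have "{e' \<in> set A. tail e' = a \<and> len e' \<le> m} \<subseteq> {e' \<in> set A. tail e' = a \<and> len e' < len e}"
      by auto
    then have "card {e' \<in> set A. tail e' = a \<and> len e' \<le> m} \<le> card {e' \<in> set A. tail e' = a \<and> len e' < len e}"
      by (intro card_mono) auto
    also have "\<dots> = length (filter (\<lambda>e'. tail e' = a \<and> len e' < len e) A)"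
      using assms(1) by (simp add: length_filter_card)
    finally show False using e(3) assms(2) by simp
  qed
  then show ?thesis unfolding weight_def foldl_max by auto
qed

text \<open>If some arc from \<open>a\<close> is longer than the weight, take a shortest such
  \<open>e\<close>. It is not counted by \<open>weight\<close>, so at least
  \<open>demand R a\<close> arcs are shorter than \<open>e\<close>, and by minimality these are
  within the weight.\<close>

lemma weight_covers:
  assumes "distinct A" "demand R a \<le> card {e \<in> set A. tail e = a}"
  shows "demand R a \<le> card {e \<in> set A. tail e = a \<and> len e \<le> weight R A a}"
proof (cases "\<forall>e\<in>set A. tail e = a \<longrightarrow> len e \<le> weight R A a")
  case True
  then have "{e \<in> set A. tail e = a \<and> len e \<le> weight R A a} = {e \<in> set A. tail e = a}" by auto
  with assms(2) show ?thesis by simp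
next
  case False
  let ?X = "{e \<in> set A. tail e = a \<and> weight R A a < len e}"
  obtain e0 where "e0 \<in> ?X" using False by force
  then obtain e where e: "e \<in> ?X" "\<And>e'. e' \<in> ?X \<Longrightarrow> len e \<le> len e'"
    using ex_has_least_nat[of "\<lambda>e. e \<in> ?X" e0 "\<lambda>e. len e"] by blast
  have "\<not> length (filter (\<lambda>e'. tail e' = a \<and> len e' < len e) A) < demand R a"
  proof
    assume "length (filter (\<lambda>e'. tail e' = a \<and> len e' < len e) A) < demand R a"
    with e(1) have "len e \<le> weight R A a" unfolding weight_def foldl_max by (intro Max_ge) auto
    with e(1) show False by simp
  qed
  then have "demand R a \<le> length (filter (\<lambda>e'. tail e' = a \<and> len e' < len e) A)" by simp
  also have "\<dots> = card {e' \<in> set A. tail e' = a \<and> len e' < len e}"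
    using assms(1) by (simp add: length_filter_card)
  also have "\<dots> \<le> card {e \<in> set A. tail e = a \<and> len e \<le> weight R A a}"
  proof (intro card_mono subsetI)
    fix e' assume "e' \<in> {e' \<in> set A. tail e' = a \<and> len e' < len e}"
    with e(2)[of e'] show "e' \<in> {e \<in> set A. tail e = a \<and> len e \<le> weight R A a}" by force
  qed simp
  finally show ?thesis .
qed

section \<open>Correctness on encoded instances\<close>

lemma ex_optimal_cover:
  assumes "mpemc_instance I" "\<exists>J. edge_cover_of I J"
  obtains J where "edge_cover_of I J" "power_of (cost I) J (verts I) = opt_power I"
proof -
  have "finite (edges I)"
    using assms(1) unfolding mpemc_instance_def
    by (auto intro: finite_subset[of _ "Pow (verts I)"])
  then have "finite {J. edge_cover_of I J}"
    by (auto simp: edge_cover_of_def intro: finite_subset[of _ "Pow (edges I)"])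
  then have "finite {power_of (cost I) J (verts I) |J. edge_cover_of I J}" by simp
  from Min_in[OF this] assms(2) show ?thesis using that unfolding opt_power_def by force
qed

definition instance_list :: "nat mpemc \<Rightarrow> (nat \<times> nat) list \<Rightarrow> edge_item list" where
  "instance_list I ps = map (\<lambda>p. (p, nat (fst (quotient_of (cost I (pair_edge p)))),
     nat (snd (quotient_of (cost I (pair_edge p)))))) ps"

lemma enc_instance:
  "enc (map (\<lambda>v. (v, req I v)) vs, instance_list I ps) = Pair
     (list_val (map (\<lambda>v. Pair (Num v) (Num (req I v))) vs))
     (list_val (map (\<lambda>(u, v). Pair (Pair (Num u) (Num v)) (rat_val (cost I {u, v}))) ps))"
  by (auto simp: enc_list_def instance_list_def enc_nat_def rat_val_def pair_edge_def enc_prod_def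
    intro!: arg_cong[where f = list_val])

lemma enc_output:
  "enc (ps :: (nat \<times> nat) list) = list_val (map (\<lambda>(u, v). Pair (Num u) (Num v)) ps)"
  by (auto simp: enc_list_def enc_nat_def enc_prod_def intro!: arg_cong[where f = list_val])

section \<open>The arcs of a listed instance\<close>

locale listed_instance =
  fixes I :: "nat mpemc" and vs :: "nat list" and ps :: "(nat \<times> nat) list"
  assumes inst: "mpemc_instance I" and vs: "distinct vs" "set vs = verts I"
    and ps: "distinct (map pair_edge ps)" "pair_edge ` set ps = edges I"
begin

definition R where "R = map (\<lambda>v. (v, req I v)) vs"
definition es where "es = instance_list I ps"
definition A where "A = arcs_of es"
definition D where "D = common_den es"
text \<open>The scaled cost as a function of edges instead of list items. The floor only yields the
  type \<open>nat\<close>; it is exact on the edges of the instance (\<open>C_cost\<close>).\<close>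

definition C :: "nat set \<Rightarrow> nat" where "C f = nat \<lfloor>of_nat D * cost I f\<rfloor>"

lemma den_pos: "x \<in> set es \<Longrightarrow> 0 < snd (snd x)"
  using quotient_of_denom_pos' by (auto simp: es_def instance_list_def)

lemma D_pos: "0 < D"
  unfolding D_def by (rule common_den_pos) (rule den_pos)

lemma es_mem: "p \<in> set ps \<Longrightarrow> \<exists>x\<in>set es. fst x = p"
  by (simp add: es_def instance_list_def)

lemma es_edge: "x \<in> set es \<Longrightarrow> pair_edge (fst x) \<in> edges I"
  using ps(2) by (auto simp: es_def instance_list_def)

lemma scaled_cost:
  assumes "x \<in> set es"
  shows "of_nat (scaled es x) = (of_nat D * cost I (pair_edge (fst x)) :: rat)"
proof -
  from assms obtain p where p: "p \<in> set ps"
    "x = (p, nat (fst (quotient_of (cost I (pair_edge p)))), nat (snd (quotient_of (cost I (pair_edge p)))))"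
    by (auto simp: es_def instance_list_def)
  obtain n d where nd: "quotient_of (cost I (pair_edge p)) = (n, d)" by fastforce
  have c: "cost I (pair_edge p) = of_int n / of_int d" "0 < d"
    using quotient_of_div[OF nd] quotient_of_denom_pos[OF nd] by auto
  have "0 \<le> cost I (pair_edge p)" using inst ps(2) p(1) by (auto simp: mpemc_instance_def)
  then have n: "0 \<le> n" using c by (simp add: zero_le_divide_iff)
  \<comment> \<open>Hence the integer division in \<open>scaled\<close> is exact.\<close>
  have "nat d dvd D" using common_den_dvd[OF assms] p(2) nd by (simp add: D_def)
  then obtain m where m: "D = nat d * m" by blast
  have "scaled es x = nat n * m"
    using c(2) p(2) nd m by (simp add: scaled_def D_def[symmetric])
  then show ?thesis using c n p(2) m by simp
qed

lemma C_cost: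
  assumes "f \<in> edges I"
  shows "of_nat (C f) = (of_nat D * cost I f :: rat)"
proof -
  from assms have "f \<in> pair_edge ` set ps" by (simp add: ps(2))
  then obtain p where "p \<in> set ps" "pair_edge p = f" by blast
  with es_mem obtain x where "x \<in> set es" "pair_edge (fst x) = f" by blast
  from scaled_cost[OF this(1), symmetric] this(2) show ?thesis by (simp add: C_def)
qed

lemma scaled_C: "x \<in> set es \<Longrightarrow> scaled es x = C (pair_edge (fst x))"
  by (simp add: C_def scaled_cost[symmetric])

lemma edge_ends:
  assumes "f \<in> edges I" "v \<in> f"
  obtains u where "f = {v, u}" "u \<noteq> v" "u \<in> verts I" "v \<in> verts I"
proof -
  from inst assms(1) obtain a b where ab: "f = {a, b}" "a \<in> verts I" "b \<in> verts I" "a \<noteq> b"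
    unfolding mpemc_instance_def by blast
  with assms(2) consider "v = a" | "v = b" by auto
  then show ?thesis
  proof cases
    case 1 with ab show ?thesis by (intro that[of b]) auto
  next
    case 2 with ab show ?thesis by (intro that[of a]) auto
  qed
qed

text \<open>Frees the comparison with covers from the order and the orientation in which the edges
  are listed.\<close>

lemma set_A: "e \<in> set A \<longleftrightarrow> {tail e, head e} \<in> edges I \<and> len e = C {tail e, head e}"
proof
  assume "e \<in> set A"
  then obtain x where x: "x \<in> set es" "e = (fst (fst x), snd (fst x), scaled es x) \<or>
      e = (snd (fst x), fst (fst x), scaled es x)"
    by (auto simp: A_def arcs_of_def)
  from x(2) have "{tail e, head e} = pair_edge (fst x)" "len e = scaled es x"
    by (auto simp: pair_edge_def)
  with x(1) show "{tail e, head e} \<in> edges I \<and> len e = C {tail e, head e}"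
    by (simp add: es_edge scaled_C)
next
  assume e: "{tail e, head e} \<in> edges I \<and> len e = C {tail e, head e}"
  then have "{tail e, head e} \<in> pair_edge ` set ps" by (simp add: ps(2))
  then obtain p where p: "p \<in> set ps" "pair_edge p = {tail e, head e}" by blast
  with es_mem obtain x where x: "x \<in> set es" "fst x = p" by blast
  then have "scaled es x = len e" using e p by (simp add: scaled_C)
  moreover from p(2) have "p = (tail e, head e) \<or> p = (head e, tail e)"
    by (cases p) (auto simp: pair_edge_def doubleton_eq_iff)
  ultimately have "e = (fst (fst x), snd (fst x), scaled es x) \<or> e = (snd (fst x), fst (fst x), scaled es x)"
    using x(2) by (cases e) auto
  with x(1) show "e \<in> set A" by (auto simp: A_def arcs_of_def)
qed

text \<open>Each half of the list inherits distinctness from \<open>ps\<close>. An arc in both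
  halves would come from a loop or from an edge listed in both orientations.\<close>

lemma distinct_A: "distinct A"
proof -
  have inj: "inj_on pair_edge (set ps)" "distinct ps" using ps(1) by (auto simp: distinct_map)
  have map_es: "map f es = map (\<lambda>p. f (p, nat (fst (quotient_of (cost I (pair_edge p)))),
     nat (snd (quotient_of (cost I (pair_edge p)))))) ps" for f :: "edge_item \<Rightarrow> arc"
    by (simp add: es_def instance_list_def)
  have ne: "fst p \<noteq> snd p" if "p \<in> set ps" for p
  proof -
    have "pair_edge p \<in> edges I" using that ps(2) by blast
    moreover have "fst p \<in> pair_edge p" by (simp add: pair_edge_def)
    ultimately obtain u where "pair_edge p = {fst p, u}" "u \<noteq> fst p" by (rule edge_ends)
    then show ?thesis by (auto simp: pair_edge_def)
  qed
  have swap: "\<not> (fst p = snd p' \<and> snd p = fst p')" if p: "p \<in> set ps" "p' \<in> set ps" for p p'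
  proof
    assume c: "fst p = snd p' \<and> snd p = fst p'"
    then have "pair_edge p = pair_edge p'" by (simp only: pair_edge_def insert_commute)
    from inj_onD[OF inj(1) this p] have "p = p'" .
    with c ne[OF p(1)] show False by blast
  qed
  show ?thesis
    unfolding A_def arcs_of_def map_es distinct_append distinct_map fst_conv
  proof (intro conjI equals0I)
    let ?c = "\<lambda>p. scaled es (p, nat (fst (quotient_of (cost I (pair_edge p)))),
        nat (snd (quotient_of (cost I (pair_edge p)))))"
    fix e assume "e \<in> set (map (\<lambda>p. (fst p, snd p, ?c p)) ps) \<inter> set (map (\<lambda>p. (snd p, fst p, ?c p)) ps)"
    then obtain p p' where "p \<in> set ps" "p' \<in> set ps"
      "e = (fst p, snd p, ?c p)" "e = (snd p', fst p', ?c p')"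
      unfolding set_map by blast
    then show False using swap[of p p'] by simp
  qed (use inj(2) in \<open>auto simp: inj_on_def prod_eq_iff\<close>)
qed

lemma finite_edges: "finite (edges I)"
  using ps(2) by (metis List.finite_set finite_imageI)

lemma finite_incident: "J \<subseteq> edges I \<Longrightarrow> finite (incident J v)"
  using finite_edges unfolding incident_def by (auto intro: finite_subset)

lemma arc_eqI:
  assumes "e \<in> set A" "e' \<in> set A" "tail e = tail e'" "{tail e, head e} = {tail e', head e'}"
  shows "e = e'"
  using assms by (auto simp: set_A prod_eq_iff doubleton_eq_iff)

lemma demand_R: "v \<in> verts I \<Longrightarrow> demand R v = req I v"
  using vs by (simp add: R_def demand_map)

text \<open>Any feasible \<open>J\<close> can be compared with: \<open>P\<close> holds both
  orientations of its edges, and \<open>\<pi>\<close> its node powers for scaled costs. The scaling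
  factor \<open>D\<close> cancels at the end.\<close>

lemma greedy_cover_instance:
  assumes J: "edge_cover_of I J"
  obtains T where "T = greedy_cover (demand R) (weight R A) A (max_req I)"
    "edge_cover_of I ((\<lambda>e. {tail e, head e}) ` set T)"
    "power_of (cost I) ((\<lambda>e. {tail e, head e}) ` set T) (verts I)
      \<le> of_nat (12 * floorlog 2 (max_req I)) * power_of (cost I) J (verts I)"
proof -
  define P where "P = {e \<in> set A. {tail e, head e} \<in> J}"
  define \<pi> where "\<pi> v = (if incident J v = {} then 0 else Max (C ` incident J v))" for v
  have J_E: "J \<subseteq> edges I" and J_deg: "\<And>v. v \<in> verts I \<Longrightarrow> req I v \<le> card (incident J v)"
    using J by (auto simp: edge_cover_of_def degree_in_def)
  have C_le: "C f \<le> \<pi> v" if "f \<in> J" "v \<in> f" for f v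
    using that finite_incident[OF J_E, of v] by (auto simp: \<pi>_def incident_def)
  have arc: "\<exists>e\<in>P. tail e = v \<and> {tail e, head e} = f" "\<exists>e\<in>P. head e = v \<and> {tail e, head e} = f"
    if "f \<in> J" "v \<in> f" for f v
  proof -
    from that J_E obtain u where u: "f = {v, u}" by (meson edge_ends subsetD)
    have "(v, u, C f) \<in> P" "(u, v, C f) \<in> P"
      using that u J_E by (auto simp: P_def set_A insert_commute)
    with u show "\<exists>e\<in>P. tail e = v \<and> {tail e, head e} = f" "\<exists>e\<in>P. head e = v \<and> {tail e, head e} = f"
      by (force simp: insert_commute)+
  qed
  have P_le: "len e \<le> \<pi> (tail e) \<and> len e \<le> \<pi> (head e)" if "e \<in> P" for e
    using that C_le[of "{tail e, head e}"] by (auto simp: P_def set_A)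
  have finP: "finite P" by (simp add: P_def)
  have P_deg: "demand R v \<le> card {e \<in> P. tail e = v}" if v: "v \<in> verts I" for v
  proof -
    have "incident J v \<subseteq> (\<lambda>e. {tail e, head e}) ` {e \<in> P. tail e = v}"
    proof
      fix f assume "f \<in> incident J v"
      with arc(1)[of f v] show "f \<in> (\<lambda>e. {tail e, head e}) ` {e \<in> P. tail e = v}"
        unfolding incident_def by blast
    qed
    then have "card (incident J v) \<le> card {e \<in> P. tail e = v}"
      using finP by (intro surj_card_le) auto
    with J_deg[OF v] show ?thesis by (simp add: demand_R[OF v])
  qed
  have P_tight: "\<exists>s\<in>set A. head s = head e \<and> len s = \<pi> (head e)" if e: "e \<in> P" for e
  proof -
    have "{tail e, head e} \<in> incident J (head e)" using e by (simp add: P_def incident_def)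
    \<comment> \<open>The maximum is attained by an edge of \<open>J\<close>; oriented towards
      \<open>head e\<close>, it is the arc sought.\<close>
    then have "\<pi> (head e) \<in> C ` incident J (head e)"
      using Max_in[of "C ` incident J (head e)"] finite_incident[OF J_E, of "head e"] by (auto simp: \<pi>_def)
    then obtain f where f: "f \<in> J" "head e \<in> f" "\<pi> (head e) = C f" by (auto simp: incident_def)
    from arc(2)[OF f(1,2)] obtain s where "s \<in> P" "head s = head e" "{tail s, head s} = f" by blast
    with f(3) show ?thesis by (auto simp: P_def set_A)
  qed
  have A_deg: "demand R v \<le> card {e \<in> set A. tail e = v}" if v: "v \<in> verts I" for v
    using P_deg[OF v] by (rule order_trans) (auto simp: P_def intro: card_mono)
  have A_V: "tail e \<in> verts I \<and> head e \<in> verts I" if "e \<in> set A" for e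
    using that inst by (auto simp: set_A mpemc_instance_def doubleton_eq_iff dest!: subsetD)
  interpret arc_cover "verts I" "demand R" "weight R A" A P \<pi>
  proof
    show "finite (verts I)" using inst by (simp add: mpemc_instance_def)
    show "weight R A v \<le> \<pi> v" if v: "v \<in> verts I" for v
    proof (rule weight_le[OF distinct_A])
      have "{e \<in> P. tail e = v} \<subseteq> {e \<in> set A. tail e = v \<and> len e \<le> \<pi> v}"
        using P_le by (auto simp: P_def)
      then have "card {e \<in> P. tail e = v} \<le> card {e \<in> set A. tail e = v \<and> len e \<le> \<pi> v}"
        by (intro card_mono) simp
      with P_deg[OF v] show "demand R v \<le> card {e \<in> set A. tail e = v \<and> len e \<le> \<pi> v}"
        by (rule le_trans)
    qed
    show "e = e'" if "e \<in> set A" "e' \<in> set A" "tail e = tail e'" "head e = head e'" for e e'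
      using that by (intro arc_eqI) auto
  qed (use distinct_A A_V P_le P_deg P_tight weight_covers[OF distinct_A A_deg] in \<open>auto simp: P_def\<close>)
  have req_le: "req I v \<le> max_req I" if "v \<in> verts I" for v
    unfolding max_req_def using finV that by simp
  have "max_req I \<le> length A"
    unfolding max_req_def
  proof (rule Max.boundedI)
    show "finite (insert 0 (req I ` verts I))" using finV by simp
    show "k \<le> length A" if "k \<in> insert 0 (req I ` verts I)" for k
    proof (cases "k = 0")
      case False
      with that obtain v where v: "v \<in> verts I" "k = demand R v" by (auto simp: demand_R)
      have "card {e \<in> set A. tail e = v} \<le> card (set A)" by (intro card_mono) auto
      also have "\<dots> \<le> length A" by (rule card_length)
      finally show ?thesis using A_deg[OF v(1)] v(2) by simp
    qed simp
  qed simp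
  then have k_less: "max_req I < 2 ^ length A" using less_exp[of "length A"] by (rule le_less_trans)
  define T where "T = greedy_cover (demand R) (weight R A) A (max_req I)"
  obtain q where q: "set T \<subseteq> set A" "distinct T" "powered T q"
    "sum q (verts I) \<le> 12 * floorlog 2 (max_req I) * sum \<pi> (verts I)"
    "\<And>a. a \<in> verts I \<Longrightarrow> demand R a \<le> outdeg T a"
    unfolding T_def by (rule greedy_cover_correct[OF _ k_less]) (simp_all add: demand_R req_le)
  let ?K = "(\<lambda>e. {tail e, head e}) ` set T"
  have K_E: "?K \<subseteq> edges I" using q(1) by (auto simp: set_A)
  have "req I v \<le> degree_in ?K v" if v: "v \<in> verts I" for v
  proof -
    \<comment> \<open>\<open>T\<close> may contain both orientations of an edge, but these have
      different tails, so the arcs serving one \<open>v\<close> remain distinct as edges.\<close>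
    have "inj_on (\<lambda>e. {tail e, head e}) {e \<in> set T. tail e = v}"
    proof (rule inj_onI)
      fix e e' assume "e \<in> {e \<in> set T. tail e = v}" "e' \<in> {e \<in> set T. tail e = v}"
        "{tail e, head e} = {tail e', head e'}"
      with q(1) show "e = e'" by (intro arc_eqI) auto
    qed
    then have "card {e \<in> set T. tail e = v} \<le> card (incident ?K v)"
      by (rule card_inj_on_le) (auto simp: incident_def)
    with q(5)[OF v] show ?thesis by (simp add: demand_R[OF v] degree_in_def outdeg_card[OF q(2)])
  qed
  with K_E have cover: "edge_cover_of I ?K" by (simp add: edge_cover_of_def)
  have "of_nat D * node_power (cost I) ?K v \<le> of_nat (q v)" for v
  proof (cases "incident ?K v = {}")
    case False
    then have "node_power (cost I) ?K v \<in> cost I ` incident ?K v"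
      using Max_in[of "cost I ` incident ?K v"] finite_incident[OF K_E, of v] by (auto simp: node_power_def)
    then obtain e where e: "e \<in> set T" "v \<in> {tail e, head e}"
      "node_power (cost I) ?K v = cost I {tail e, head e}"
      by (auto simp: incident_def)
    with q(1) have "{tail e, head e} \<in> edges I" "len e = C {tail e, head e}" by (auto simp: set_A)
    moreover have "len e \<le> q v" using q(3) e(1,2) by (auto simp: powered_def)
    ultimately show ?thesis using C_cost[of "{tail e, head e}"] e(3) by (metis of_nat_mono)
  qed (simp add: node_power_def)
  then have "of_nat D * power_of (cost I) ?K (verts I) \<le> of_nat (sum q (verts I))"
    unfolding power_of_def sum_distrib_left of_nat_sum by (intro sum_mono)
  also have "\<dots> \<le> of_nat (12 * floorlog 2 (max_req I) * sum \<pi> (verts I))"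
    using q(4) by (rule of_nat_mono)
  also have "\<dots> = of_nat (12 * floorlog 2 (max_req I)) * (\<Sum>v\<in>verts I. of_nat (\<pi> v))" by simp
  also have "\<dots> \<le> of_nat (12 * floorlog 2 (max_req I)) * (of_nat D * power_of (cost I) J (verts I))"
  proof -
    have "of_nat (\<pi> v) \<le> of_nat D * node_power (cost I) J v" for v
    proof (cases "incident J v = {}")
      case False
      then have "\<pi> v \<in> C ` incident J v"
        using Max_in[of "C ` incident J v"] finite_incident[OF J_E, of v] by (auto simp: \<pi>_def)
      then obtain f where f: "f \<in> incident J v" "\<pi> v = C f" by auto
      have "cost I f \<le> node_power (cost I) J v"
        using f(1) finite_incident[OF J_E, of v] by (auto simp: node_power_def)
      moreover have "f \<in> edges I" using f(1) J_E by (auto simp: incident_def)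
      ultimately show ?thesis by (simp add: f(2) C_cost mult_left_mono)
    qed (simp add: \<pi>_def node_power_def)
    then show ?thesis
      unfolding power_of_def sum_distrib_left[of "of_nat D"] by (intro mult_left_mono sum_mono) auto
  qed
  also have "\<dots> = of_nat D * (of_nat (12 * floorlog 2 (max_req I)) * power_of (cost I) J (verts I))"
    by (simp add: mult_ac)
  finally have "power_of (cost I) ?K (verts I)
      \<le> of_nat (12 * floorlog 2 (max_req I)) * power_of (cost I) J (verts I)"
    using D_pos by (simp only: mult_le_cancel_left_pos of_nat_0_less_iff)
  with that[of T] cover show ?thesis by (simp add: T_def)
qed

end

section \<open>The logarithmic ratio and the resulting algorithm\<close>

lemma floorlog_bigo_ln: "(\<lambda>k. 12 * real (floorlog 2 k)) \<in> O(\<lambda>k. ln (real k))"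
proof (rule bigoI)
  show "\<forall>\<^sub>F k in sequentially. norm (12 * real (floorlog 2 k)) \<le> (24 / ln 2) * norm (ln (real k))"
  proof (rule eventually_sequentiallyI)
    fix k :: nat assume k: "2 \<le> k"
    have "floorlog 2 k = nat \<lfloor>log 2 (real k)\<rfloor> + 1" using k by (simp add: floorlog_def)
    \<comment> \<open>From \<open>k = 2\<close> on, the additive 1 in \<open>floorlog\<close> is
      absorbed by doubling the logarithm, which turns 12 into 24.\<close>
    moreover have "1 \<le> log 2 (real k)" using k by simp
    ultimately have "real (floorlog 2 k) \<le> 2 * log 2 (real k)" by linarith
    then show "norm (12 * real (floorlog 2 k)) \<le> (24 / ln 2) * norm (ln (real k))"
      using k by (simp add: log_def)
  qed
qed

theorem theorem1:
  shows "\<exists>(A :: prog) (\<rho> :: nat \<Rightarrow> real).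
    \<rho> \<in> O(\<lambda>k. ln (real k)) \<and> mpemc_approximation_algorithm A \<rho>"
proof -
  obtain Pr p where run: "\<And>x. \<exists>t\<le>poly p (sz x). runs_to Pr (enc x) (enc (solve x)) t"
    by (rule ptime_program[OF ptime_solve]) (rule that)
  have list: "\<exists>vs ps. listed_instance I vs ps \<and> x = enc (map (\<lambda>v. (v, req I v)) vs, instance_list I ps)"
    if "mpemc_instance I" "encodes_instance x I" for I x
    using that unfolding encodes_instance_def listed_instance_def enc_instance by blast
  have "polytime_on_instances Pr"
    unfolding polytime_on_instances_def
  proof (intro exI[of _ p] allI impI)
    fix I x assume "mpemc_instance I \<and> encodes_instance x I"
    with list obtain vs ps where "x = enc (map (\<lambda>v. (v, req I v)) vs, instance_list I ps)" by blast
    with run show "\<exists>y t. runs_to Pr x y t \<and> t \<le> poly p (vsize x)" unfolding sz_def by blast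
  qed
  moreover have "\<exists>y t J. runs_to Pr x y t \<and> encodes_edges y J \<and> edge_cover_of I J \<and>
      of_rat (power_of (cost I) J (verts I)) \<le> 12 * real (floorlog 2 (max_req I)) * of_rat (opt_power I)"
    if I: "mpemc_instance I" "encodes_instance x I" "\<exists>J. edge_cover_of I J" for I x
  proof -
    obtain vs ps where l: "listed_instance I vs ps"
      and x: "x = enc (map (\<lambda>v. (v, req I v)) vs, instance_list I ps)"
      using list[OF I(1,2)] by blast
    interpret listed_instance I vs ps by (rule l)
    obtain J where J: "edge_cover_of I J" "power_of (cost I) J (verts I) = opt_power I"
      using ex_optimal_cover[OF I(1,3)] by blast
    obtain T where T: "T = greedy_cover (demand R) (weight R A) A (max_req I)"
      "edge_cover_of I ((\<lambda>e. {tail e, head e}) ` set T)"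
      "power_of (cost I) ((\<lambda>e. {tail e, head e}) ` set T) (verts I)
        \<le> of_nat (12 * floorlog 2 (max_req I)) * power_of (cost I) J (verts I)"
      by (rule greedy_cover_instance[OF J(1)])
    \<comment> \<open>The \<open>0\<close> inserted in \<open>max_req\<close> matches the start
      value of the fold, also without vertices.\<close>
    have "max_req I = foldl max 0 (map snd R)"
      using vs(2) by (simp add: max_req_def foldl_max R_def comp_def)
    then have sol: "solve (R, es) = map (\<lambda>e. (tail e, head e)) T"
      by (simp add: solve_def T(1) A_def)
    have x': "x = enc (R, es)" by (simp only: x R_def es_def)
    obtain t where t: "runs_to Pr x (enc (solve (R, es))) t" unfolding x' using run by blast
    have "encodes_edges (enc (solve (R, es))) ((\<lambda>e. {tail e, head e}) ` set T)"
      unfolding encodes_edges_def enc_output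
      by (intro exI[of _ "solve (R, es)"]) (simp add: sol pair_edge_def image_image)
    moreover have "(of_rat (power_of (cost I) ((\<lambda>e. {tail e, head e}) ` set T) (verts I)) :: real)
        \<le> of_rat (of_nat (12 * floorlog 2 (max_req I)) * opt_power I)"
      using T(3) J(2) by (simp only: of_rat_less_eq)
    then have "(of_rat (power_of (cost I) ((\<lambda>e. {tail e, head e}) ` set T) (verts I)) :: real)
        \<le> 12 * real (floorlog 2 (max_req I)) * of_rat (opt_power I)"
      by (simp add: of_rat_mult)
    ultimately show ?thesis using t T(2) by blast
  qed
  ultimately have "mpemc_approximation_algorithm Pr (\<lambda>k. 12 * real (floorlog 2 k))"
    unfolding mpemc_approximation_algorithm_def by blast
  with floorlog_bigo_ln show ?thesis by blast
qed

end
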